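(* $\mathfrak{sp}\geq\mathrm{cov}(\mathcal{M})$ and $\mathfrak{sp}\geq\mathrm{cov}(\mathcal{N})$.
   Context: A compactification $\alpha\omega$ of the countable discrete space $\omega$ is a compact Hausdorff space containing $\omega$ as a dense subspace. $\alpha\omega\leq\gamma\omega$ means there is a continuous surjection $f:\gamma\omega\to\alpha\omega$ whose restriction to $\omega$ is the identity; $\alpha\omega\simeq\gamma\omega$ means such an $f$ can be chosen to be a homeomorphism. Modulo $\simeq$, compactifications of $\omega$ ordered by $\leq$ form a complete upper semilattice with largest element the Stone–Čech compactification $\beta\omega$; $\sup$ is taken in it. $C_{\alpha\omega}$ denotes the set of bounded functions $\omega\to\mathbb{R}$ that extend continuously over $\alpha\omega$; it determines $\alpha\omega$ up to $\simeq$, and every subring of the ring of bounded functions on $\omega$ that is closed in the uniform norm, contains all constants and generates the topology of $\omega$ is of this form. $\mathrm{M}(\omega)$ is the set of all metrics on $\omega$ compatible with the discrete topology. For $d\in\mathrm{M}(\omega)$, the Smirnov compactification $u_d\omega$ is the compactification with $C_{u_d\omega}=U^*_d(\omega)$, the ring of all bounded uniformly continuous functions from $(\omega,d)$ to $\mathbb{R}$. $\mathrm{M}'(\omega)$ is the set of $d\in\mathrm{M}(\omega)$ with $\beta\omega\not\simeq u_d\omega$. A set $D\subseteq\mathrm{M}'(\omega)$ has the Smirnov finite intersection property (Smirnov-FIP) if for every finite $F\subseteq D$, $\beta\omega\not\simeq\sup\{u_d\omega: d\in F\}$. $\mathfrak{sp}$ is the smallest cardinality of a set $D\subseteq\mathrm{M}'(\omega)$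 with the Smirnov-FIP such that $\beta\omega\simeq\sup\{u_d\omega: d\in D\}$. $\mathcal{M}$ and $\mathcal{N}$ are the ideals of meager and of measure zero subsets of the Cantor space $2^\omega$ (with the usual product measure). For a collection $\mathcal{X}$ of subsets of $2^\omega$, $\mathrm{cov}(\mathcal{X})$ is the smallest cardinality of $\mathcal{X}'\subseteq\mathcal{X}$ with $\bigcup\mathcal{X}'=2^\omega$. Convention: if no set of the required kind exists, the cardinal being defined is $\infty$, and $\lambda<\infty$ for every cardinal $\lambda$. *)

theory Defs
  imports "HOL-Probability.Probability"
begin

unbundle cardinal_syntax

text \<open>
  A compactification is given by a compact Hausdorff space \<open>K\<close> together with a dense
  embedding \<open>e\<close> of the discrete space of natural numbers; \<open>e\<close> replaces the inclusion, so
  \<open>f\<close> restricting to the identity on \<open>\<omega>\<close> reads \<open>f (g n) = e n\<close>.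
\<close>

fun compactification :: "'a topology \<times> (nat \<Rightarrow> 'a) \<Rightarrow> bool" where
  "compactification (K, e) \<longleftrightarrow>
     compact_space K \<and> Hausdorff_space K \<and>
     embedding_map (discrete_topology UNIV) K e \<and>
     K closure_of (range e) = topspace K"

fun cpt_le :: "'a topology \<times> (nat \<Rightarrow> 'a) \<Rightarrow> 'b topology \<times> (nat \<Rightarrow> 'b) \<Rightarrow> bool" where
  "cpt_le (K, e) (L, g) \<longleftrightarrow>
     (\<exists>f. continuous_map L K f \<and> f ` topspace L = topspace K \<and> (\<forall>n. f (g n) = e n))"

fun cpt_equiv :: "'a topology \<times> (nat \<Rightarrow> 'a) \<Rightarrow> 'b topology \<times> (nat \<Rightarrow> 'b) \<Rightarrow> bool" where
  "cpt_equiv (K, e) (L, g) \<longleftrightarrow>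
     (\<exists>f. homeomorphic_map L K f \<and> (\<forall>n. f (g n) = e n))"

fun extendable_functions :: "'a topology \<times> (nat \<Rightarrow> 'a) \<Rightarrow> (nat \<Rightarrow> real) set" where
  "extendable_functions (K, e) =
     {\<phi>. bounded (range \<phi>) \<and>
         (\<exists>F. continuous_map K euclideanreal F \<and> (\<forall>n. F (e n) = \<phi> n))}"

text \<open>
  The compactifications do not form a set, so the semilattice of compactifications modulo
  equivalence is represented on one fixed carrier type. Nothing is lost: the map sending \<open>x\<close>
  to the family of the values at \<open>x\<close> of the continuous extensions of the functions in
  \<open>extendable_functions (K, e)\<close> embeds any \<open>K\<close> into a power of the real line indexed by that
  set, whose points are elements of this type. The constants below pick representatives,
  which are unique up to \<open>cpt_equiv\<close>.
\<close>

type_synonym cpt_point = "(nat \<Rightarrow> real) \<Rightarrow> real"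
type_synonym cpt = "cpt_point topology \<times> (nat \<Rightarrow> cpt_point)"

definition Stone_Cech :: cpt where
  "Stone_Cech =
     (SOME B. compactification B \<and> (\<forall>A :: cpt. compactification A \<longrightarrow> cpt_le A B))"

definition cpt_is_sup :: "cpt set \<Rightarrow> cpt \<Rightarrow> bool" where
  "cpt_is_sup S B \<longleftrightarrow>
     compactification B \<and> (\<forall>A\<in>S. cpt_le A B) \<and>
     (\<forall>C :: cpt. compactification C \<and> (\<forall>A\<in>S. cpt_le A C) \<longrightarrow> cpt_le B C)"

text \<open>The supremum of the empty family is the least (one-point) compactification.\<close>

definition cpt_sup :: "cpt set \<Rightarrow> cpt" where
  "cpt_sup S = (SOME B. cpt_is_sup S B)"

definition discrete_metrics :: "nat metric set" where
  "discrete_metrics = {d. mspace d = UNIV \<and> mtopology_of d = discrete_topology UNIV}"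

definition bounded_uniformly_continuous :: "nat metric \<Rightarrow> (nat \<Rightarrow> real) set" where
  "bounded_uniformly_continuous d =
     {\<phi>. bounded (range \<phi>) \<and> uniformly_continuous_map d euclidean_metric \<phi>}"

definition Smirnov :: "nat metric \<Rightarrow> cpt" where
  "Smirnov d =
     (SOME A. compactification A \<and> extendable_functions A = bounded_uniformly_continuous d)"

definition non_Stone_Cech_metrics :: "nat metric set" where
  "non_Stone_Cech_metrics = {d \<in> discrete_metrics. \<not> cpt_equiv Stone_Cech (Smirnov d)}"

definition Smirnov_FIP :: "nat metric set \<Rightarrow> bool" where
  "Smirnov_FIP D \<longleftrightarrow>
     (\<forall>F. finite F \<and> F \<subseteq> D \<longrightarrow> \<not> cpt_equiv Stone_Cech (cpt_sup (Smirnov ` F)))"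

text \<open>
  A cardinal is represented by a cardinal well-order, up to \<open>=o\<close>; the comparison \<open>\<le>o\<close>
  works across types.
\<close>

datatype 'a ext_card = Card "'a rel" | Infty

fun ext_card_le :: "'a ext_card \<Rightarrow> 'b ext_card \<Rightarrow> bool" where
  "ext_card_le (Card r) (Card s) \<longleftrightarrow> r \<le>o s"
| "ext_card_le x Infty \<longleftrightarrow> True"
| "ext_card_le Infty (Card s) \<longleftrightarrow> False"

definition least_card :: "('a set \<Rightarrow> bool) \<Rightarrow> 'a ext_card" where
  "least_card P =
     (if \<exists>A. P A then Card |SOME A. P A \<and> (\<forall>B. P B \<longrightarrow> |A| \<le>o |B| )| else Infty)"

definition sp :: "nat metric ext_card" where
  "sp = least_card (\<lambda>D. D \<subseteq> non_Stone_Cech_metrics \<and> Smirnov_FIP D \<and>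
                        cpt_equiv Stone_Cech (cpt_sup (Smirnov ` D)))"

definition cov :: "(nat \<Rightarrow> bool) set set \<Rightarrow> (nat \<Rightarrow> bool) set ext_card" where
  "cov \<X> = least_card (\<lambda>\<Y>. \<Y> \<subseteq> \<X> \<and> \<Union>\<Y> = UNIV)"

definition Cantor_topology :: "(nat \<Rightarrow> bool) topology" where
  "Cantor_topology = product_topology (\<lambda>_. discrete_topology UNIV) UNIV"

definition nowhere_dense_in :: "'a topology \<Rightarrow> 'a set \<Rightarrow> bool" where
  "nowhere_dense_in X A \<longleftrightarrow>
     A \<subseteq> topspace X \<and> X interior_of (X closure_of A) = {}"

definition meager_sets :: "(nat \<Rightarrow> bool) set set" where
  "meager_sets =
     {A. \<exists>N :: nat \<Rightarrow> (nat \<Rightarrow> bool) set.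
           (\<forall>n. nowhere_dense_in Cantor_topology (N n)) \<and> A = (\<Union>n. N n)}"

definition Cantor_measure :: "(nat \<Rightarrow> bool) measure" where
  "Cantor_measure = PiM UNIV (\<lambda>_. measure_pmf (bernoulli_pmf (1/2)))"

text \<open>The completion makes every subset of a Borel null set a null set.\<close>

definition measure_zero_sets :: "(nat \<Rightarrow> bool) set set" where
  "measure_zero_sets = null_sets (completion Cantor_measure)"

end

theory Submission
  imports Defs
begin

text \<open>
  Let \<open>D\<close> have the Smirnov-FIP with supremum \<open>\<beta>\<omega>\<close>. For nonempty \<open>F \<subseteq> D\<close> let \<open>S F\<close> be the algebra of
  all \<open>X \<subseteq> \<omega>\<close> whose characteristic function extends over the supremum of the \<open>u\<^sub>d\<omega>\<close>, \<open>d \<in> F\<close>. By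
  compactness, \<open>X \<in> S F\<close> iff finitely many pairs \<open>P\<^sub>i\<close>, \<open>Q\<^sub>i\<close>, each at positive distance for some
  \<open>d \<in> F\<close>, satisfy \<open>X \<times> (\<omega> - X) \<subseteq> \<Union>\<^sub>i P\<^sub>i \<times> Q\<^sub>i\<close>. Once the metrics and the distance bound are fixed, this
  condition on \<open>X\<close> is closed, so \<open>S F\<close> is an \<open>F\<^sub>\<sigma>\<close> subgroup of \<open>2\<^sup>\<omega>\<close> for finite \<open>F\<close>. It contains the
  finite sets, and it is proper by the FIP. Hence it is meager, and null by the zero-one law. The
  algebra \<open>S D\<close>, which is everything, is the union over all finite sequences of metrics in \<open>D\<close> of
  such small sets, and there are \<open>|D|\<close> many of these sequences.
\<close>

section \<open>Compactifications of a countable discrete space\<close>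

lemma compactification_eqI:
  assumes "compactification (K, e)" "Hausdorff_space X"
    and "continuous_map K X f" "continuous_map K X f'" "\<And>n. f (e n) = f' (e n)" "p \<in> topspace K"
  shows "f p = f' p"
  by (rule forall_in_closure_of_eq[of p K "range e" X f f']) (use assms in auto)

lemma compactification_range:
  assumes "compactification (K, e)"
  shows "e n \<in> topspace K"
proof -
  have "homeomorphic_map (discrete_topology UNIV) (subtopology K (range e)) e"
    using assms by (simp add: embedding_map_def)
  then have "range e = topspace (subtopology K (range e))"
    by (metis homeomorphic_imp_surjective_map topspace_discrete_topology)
  then show ?thesis by auto
qed

lemma compactification_dense:
  assumes "compactification (K, e)" "openin K W" "W \<noteq> {}"
  obtains n where "e n \<in> W"
proof -
  have "W \<inter> K closure_of range e \<noteq> {}"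
    using assms openin_subset[of K W] by auto
  then have "W \<inter> range e \<noteq> {}"
    using openin_Int_closure_of_eq_empty[OF assms(2), of "range e"] by blast
  with that show ?thesis by auto
qed

lemma extendable_functionsE:
  assumes "\<phi> \<in> extendable_functions (K, e)"
  obtains F where "continuous_map K euclideanreal F" "\<And>n. F (e n) = \<phi> n"
  using assms by auto

text \<open>Both spaces are mapped into a power of the real line, where the image of \<open>K\<close> is closed.\<close>

lemma cpt_leI:
  fixes F :: "'i \<Rightarrow> 'a \<Rightarrow> real" and G :: "'i \<Rightarrow> 'b \<Rightarrow> real"
  assumes K: "compactification (K, e)" and L: "compactification (L, g)"
    and F: "\<And>i. i \<in> I \<Longrightarrow> continuous_map K euclideanreal (F i)"
    and G: "\<And>i. i \<in> I \<Longrightarrow> continuous_map L euclideanreal (G i)"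
    and eq: "\<And>i n. i \<in> I \<Longrightarrow> F i (e n) = G i (g n)"
    and sep: "\<And>p q. \<lbrakk>p \<in> topspace K; q \<in> topspace K; p \<noteq> q\<rbrakk> \<Longrightarrow> \<exists>i\<in>I. F i p \<noteq> F i q"
  shows "cpt_le (K, e) (L, g)"
proof -
  define X where "X = product_topology (\<lambda>_::'i. euclideanreal) I"
  \<comment> \<open>Both evaluation maps use the same index set, so \<open>\<Phi>\<close> on
    \<open>K\<close> and \<open>\<Gamma>\<close> on \<open>L\<close> agree along \<omega>.\<close>
  define \<Phi> where "\<Phi> = (\<lambda>p. \<lambda>i\<in>I. F i p)"
  define \<Gamma> where "\<Gamma> = (\<lambda>p. \<lambda>i\<in>I. G i p)"
  have HX: "Hausdorff_space X"
    by (simp add: X_def Hausdorff_space_product_topology)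
  have c\<Phi>: "continuous_map K X \<Phi>" and c\<Gamma>: "continuous_map L X \<Gamma>"
    using F G by (auto simp: X_def \<Phi>_def \<Gamma>_def continuous_map_componentwise)
  have inj: "inj_on \<Phi> (topspace K)"
  proof (rule inj_onI, rule ccontr)
    fix p q assume pq: "p \<in> topspace K" "q \<in> topspace K" "\<Phi> p = \<Phi> q" "p \<noteq> q"
    then obtain i where i: "i \<in> I" "F i p \<noteq> F i q" using sep by blast
    have "\<Phi> p i = \<Phi> q i" using pq(3) by simp
    with i show False by (simp add: \<Phi>_def)
  qed
  have emb: "embedding_map K X \<Phi>"
    using continuous_imp_embedding_map[OF c\<Phi> _ HX inj] K by simp
  then obtain h where h: "homeomorphic_maps K (subtopology X (\<Phi> ` topspace K)) \<Phi> h"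
    unfolding embedding_map_def homeomorphic_map_maps by blast
  have clo: "closedin X (\<Phi> ` topspace K)"
    using K by (intro compactin_imp_closedin[OF HX] image_compactin[OF _ c\<Phi>])
      (simp flip: compact_space_def)
  have eg: "\<Phi> (e n) = \<Gamma> (g n)" for n
    using eq by (auto simp: \<Phi>_def \<Gamma>_def)
  \<comment> \<open>Density of \<omega> in \<open>L\<close> forces all of \<open>\<Gamma>(L)\<close>
    into the closed image of \<open>K\<close>, where the inverse \<open>h\<close> of
    \<open>\<Phi>\<close> is available.\<close>
  have "\<Gamma> ` topspace L \<subseteq> X closure_of (\<Gamma> ` range g)"
    using continuous_map_image_closure_subset[OF c\<Gamma>, of "range g"] L by simp
  also have "\<dots> \<subseteq> \<Phi> ` topspace K"
    by (rule closure_of_minimal[OF _ clo]) (use compactification_range[OF K] in \<open>simp add: image_subset_iff flip: eg\<close>)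
  finally have "continuous_map L (subtopology X (\<Phi> ` topspace K)) \<Gamma>"
    using c\<Gamma> by (auto simp: continuous_map_in_subtopology)
  then have cf: "continuous_map L K (h \<circ> \<Gamma>)"
    using h unfolding homeomorphic_maps_def by (blast intro: continuous_map_compose)
  have fg: "(h \<circ> \<Gamma>) (g n) = e n" for n
    using h compactification_range[OF K] unfolding homeomorphic_maps_def
    by (simp flip: eg)
  \<comment> \<open>Surjectivity: the image is compact, hence closed, and it contains the dense copy
    of \<omega>.\<close>
  have "closedin K ((h \<circ> \<Gamma>) ` topspace L)"
    using K L by (intro compactin_imp_closedin image_compactin[OF _ cf])
      (simp_all flip: compact_space_def)
  moreover have "range e \<subseteq> (h \<circ> \<Gamma>) ` topspace L"
    using fg compactification_range[OF L] by (metis image_iff image_subsetI)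
  ultimately have "K closure_of (range e) \<subseteq> (h \<circ> \<Gamma>) ` topspace L"
    by (simp add: closure_of_minimal)
  with K cf have "(h \<circ> \<Gamma>) ` topspace L = topspace K"
    by (auto simp: continuous_map_def)
  with cf fg show ?thesis
    unfolding cpt_le.simps by blast
qed

lemma compactification_separating:
  assumes "compactification (K, e)" "p \<in> topspace K" "q \<in> topspace K" "p \<noteq> q"
  obtains F where "continuous_map K euclideanreal F" "F p \<noteq> F q"
proof -
  have "normal_space K"
    using assms by (auto intro: compact_Hausdorff_or_regular_imp_normal_space)
  moreover have "closedin K {p}" "closedin K {q}"
    using assms by (auto simp: closedin_Hausdorff_singleton)
  ultimately obtain F where "continuous_map K euclideanreal F" "F ` {p} \<subseteq> {0}" "F ` {q} \<subseteq> {1}"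
    using Urysohn_lemma_alt[of K "{p}" "{q}" 0 1] assms by auto
  then show ?thesis
    using that by auto
qed

lemma continuous_extension_bounded:
  assumes "compactification (K, e)" "continuous_map K euclideanreal F"
  shows "bounded (range (\<lambda>n. F (e n)))"
proof -
  have "compact (F ` topspace K)"
    using image_compactin[OF _ assms(2), of "topspace K"] assms(1) by (simp flip: compact_space_def)
  then show ?thesis
    using compactification_range[OF assms(1)]
    by (intro bounded_subset[OF compact_imp_bounded]) auto
qed

text \<open>Take as indices all pairs of continuous functions on \<open>K\<close> and
  \<open>L\<close> that agree on \<omega>. Urysohn functions on \<open>K\<close> separate points,
  and by hypothesis their restrictions to \<omega> extend over \<open>L\<close>.\<close>

lemma cpt_le_if_extendable_subset:
  assumes K: "compactification (K, e)" and L: "compactification (L, g)"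
    and sub: "extendable_functions (K, e) \<subseteq> extendable_functions (L, g)"
  shows "cpt_le (K, e) (L, g)"
proof -
  define I where "I = {(F, G). continuous_map K euclideanreal F \<and>
    continuous_map L euclideanreal G \<and> (\<forall>n. F (e n) = G (g n))}"
  show ?thesis
  proof (rule cpt_leI[OF K L, of I fst snd])
    fix p q assume pq: "p \<in> topspace K" "q \<in> topspace K" "p \<noteq> q"
    obtain F where F: "continuous_map K euclideanreal F" "F p \<noteq> F q"
      using compactification_separating[OF K pq] .
    then have "(\<lambda>n. F (e n)) \<in> extendable_functions (K, e)"
      using continuous_extension_bounded[OF K] by auto
    with sub obtain G where "continuous_map L euclideanreal G" "\<And>n. G (g n) = F (e n)"
      by (auto 4 4)
    with F have "(F, G) \<in> I" by (auto simp: I_def)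
    with F show "\<exists>i\<in>I. fst i p \<noteq> fst i q" by force
  qed (auto simp: I_def)
qed

lemma extendable_mono:
  assumes "cpt_le A B"
  shows "extendable_functions A \<subseteq> extendable_functions B"
proof
  obtain K e where A: "A = (K, e)" by (rule prod.exhaust)
  obtain L g where B: "B = (L, g)" by (rule prod.exhaust)
  fix \<phi> assume \<phi>: "\<phi> \<in> extendable_functions A"
  then obtain F where F: "continuous_map K euclideanreal F" "\<And>n. F (e n) = \<phi> n"
    unfolding A by auto
  obtain f where f: "continuous_map L K f" "\<And>n. f (g n) = e n"
    using assms unfolding A B by auto
  have "continuous_map L euclideanreal (F \<circ> f)"
    using F f by (blast intro: continuous_map_compose)
  moreover have "(F \<circ> f) (g n) = \<phi> n" for n
    using F f by simp
  ultimately show "\<phi> \<in> extendable_functions B"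
    using \<phi> unfolding A B extendable_functions.simps by blast
qed

lemma cpt_equiv_imp_le:
  assumes "cpt_equiv (K, e) (L, g)"
  shows "cpt_le (K, e) (L, g)"
  using assms homeomorphic_imp_continuous_map[of L K] homeomorphic_imp_surjective_map[of L K]
  unfolding cpt_le.simps cpt_equiv.simps by metis

text \<open>The two composites fix \<omega> pointwise, so by density they are identities.\<close>

lemma cpt_equivI:
  assumes K: "compactification (K, e)" and L: "compactification (L, g)"
    and KL: "cpt_le (K, e) (L, g)" and LK: "cpt_le (L, g) (K, e)"
  shows "cpt_equiv (K, e) (L, g)"
proof -
  obtain f where f: "continuous_map L K f" "\<And>n. f (g n) = e n" using KL by auto
  obtain h where h: "continuous_map K L h" "\<And>n. h (e n) = g n" using LK by auto
  have "(h \<circ> f) y = id y" if "y \<in> topspace L" for y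
    by (rule compactification_eqI[OF L _ _ _ _ that, of L])
      (use f h L continuous_map_compose[OF f(1) h(1)] in \<open>auto simp: id_def o_def\<close>)
  moreover have "(f \<circ> h) x = id x" if "x \<in> topspace K" for x
    by (rule compactification_eqI[OF K _ _ _ _ that, of K])
      (use f h K continuous_map_compose[OF h(1) f(1)] in \<open>auto simp: id_def o_def\<close>)
  ultimately have "homeomorphic_maps L K f h"
    using f h by (simp add: homeomorphic_maps_def)
  then show ?thesis
    using f homeomorphic_maps_map unfolding cpt_equiv.simps by metis
qed

section \<open>The compactification generated by a family of bounded functions\<close>

definition evaluation :: "(nat \<Rightarrow> real) set \<Rightarrow> nat \<Rightarrow> cpt_point" where
  "evaluation R n = (\<lambda>\<phi>. if \<phi> \<in> R then \<phi> n else 0)"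

text \<open>For a suitable generating family \<open>R\<close> this is the least compactification
  over which all members of \<open>R\<close> extend, by \<open>extendable_evaluation\<close> and
  \<open>evaluation_space_le\<close>. The power is taken over all functions, so that every such
  space lives on the type \<open>cpt_point\<close>.\<close>

definition evaluation_space :: "(nat \<Rightarrow> real) set \<Rightarrow> cpt_point topology" where
  "evaluation_space R =
     (let X = product_topology (\<lambda>_. euclideanreal) UNIV in
      subtopology X (X closure_of range (evaluation R)))"

lemma continuous_map_evaluation_space:
  "continuous_map (evaluation_space R) euclideanreal (\<lambda>p. p \<phi>)"
  unfolding evaluation_space_def Let_def
  by (intro continuous_map_from_subtopology continuous_map_product_projection) auto

text \<open>Boundedness places the closure in a product of compact intervals, and the characteristic
  functions of singletons make every point of \<omega> isolated.\<close>

lemma compactification_evaluation: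
  assumes bd: "\<And>\<phi>. \<phi> \<in> R \<Longrightarrow> bounded (range \<phi>)"
    and ind: "\<And>n::nat. indicator {n} \<in> R"
  shows "compactification (evaluation_space R, evaluation R)"
proof -
  define X :: "cpt_point topology" where "X = product_topology (\<lambda>_. euclideanreal) UNIV"
  define K where "K = evaluation_space R"
  define e where "e = evaluation R"
  have KX: "K = subtopology X (X closure_of range e)"
    by (simp add: K_def X_def e_def evaluation_space_def Let_def)
  have HX: "Hausdorff_space X"
    by (simp add: X_def Hausdorff_space_product_topology)
  then have HK: "Hausdorff_space K"
    by (simp add: KX Hausdorff_space_subtopology)
  have top: "topspace K = X closure_of range e"
    using closure_of_subset_topspace[of X "range e"] by (auto simp: KX)
  have eX: "range e \<subseteq> topspace X" by (auto simp: X_def)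
  then have eK: "e n \<in> topspace K" for n
    using closure_of_subset[OF eX] top by auto
  have dense: "K closure_of range e = topspace K"
    using eK top by (simp add: KX closure_of_subtopology inf.absorb2 image_subset_iff)
  have "\<exists>B. \<forall>n. \<bar>e n \<phi>\<bar> \<le> B" for \<phi>
    using bd[of \<phi>] by (auto simp: e_def evaluation_def bounded_iff intro: exI[of _ 0])
  then obtain B where B: "\<And>n \<phi>. \<bar>e n \<phi>\<bar> \<le> B \<phi>" by metis
  define C where "C = (\<Pi>\<^sub>E \<phi>\<in>UNIV. {-B \<phi>..B \<phi>})"
  have C: "compactin X C"
    by (simp add: C_def X_def compactin_PiE)
  have "X closure_of range e \<subseteq> C"
    by (rule closure_of_minimal[OF _ compactin_imp_closedin[OF HX C]])
      (use B in \<open>auto simp: C_def abs_le_iff minus_le_iff\<close>)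
  then have "compactin X (X closure_of range e)"
    using C closed_compactin closedin_closure_of by blast
  then have cK: "compact_space K"
    by (simp add: KX compact_space_subtopology)
  have iso: "openin K {e n}" for n
  proof -
    \<comment> \<open>On the copy of \<omega> this coordinate is 1 at \<open>e n\<close> and 0
      elsewhere. Hence \<open>U - {e n}\<close> is an open set that misses the dense copy, so it is
      empty.\<close>
    define U where "U = {p \<in> topspace K. p (indicator {n}) \<in> {1/2<..}}"
    have U: "openin K U" unfolding U_def
      by (rule openin_continuous_map_preimage[OF continuous_map_evaluation_space[of R, folded K_def]]) auto
    have en: "e n \<in> U" using eK ind by (simp add: U_def e_def evaluation_def)
    have "U - {e n} = {}"
    proof (rule ccontr)
      assume "U - {e n} \<noteq> {}"
      moreover have V: "openin K (U - {e n})"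
        using U HK eK by (simp add: openin_diff closedin_Hausdorff_singleton)
      ultimately have "(U - {e n}) \<inter> K closure_of range e \<noteq> {}"
        unfolding dense using openin_subset[OF V] by blast
      then have "(U - {e n}) \<inter> range e \<noteq> {}"
        using openin_Int_closure_of_eq_empty[OF V, of "range e"] by blast
      then obtain m where "e m \<in> U - {e n}" by auto
      then show False
        using ind[of n] by (cases "m = n") (auto simp: U_def e_def evaluation_def)
    qed
    with U en show ?thesis by (metis Diff_eq_empty_iff empty_iff subset_singletonD)
  qed
  have "inj e"
  proof (rule injI)
    fix m n assume "e m = e n"
    then have "e m (indicator {n}) = e n (indicator {n})" by simp
    then show "m = n" using ind[of n] by (simp add: e_def evaluation_def split: split_indicator_asm)
  qed
  moreover have "open_map (discrete_topology UNIV) K e"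
    unfolding open_map_def
  proof safe
    fix A :: "nat set"
    have "openin K (\<Union>n\<in>A. {e n})" using iso by blast
    then show "openin K (e ` A)" by (simp add: UNION_singleton_eq_range)
  qed
  moreover have "continuous_map (discrete_topology UNIV) K e"
    using eK by (auto simp: continuous_map_def)
  ultimately have "embedding_map (discrete_topology UNIV) K e"
    by (intro injective_open_imp_embedding_map) auto
  with cK HK dense show ?thesis
    by (simp add: K_def e_def)
qed

lemma extendable_evaluation:
  assumes "\<phi> \<in> R" "bounded (range \<phi>)"
  shows "\<phi> \<in> extendable_functions (evaluation_space R, evaluation R)"
  using assms continuous_map_evaluation_space[of R \<phi>]
  by (auto simp: evaluation_def intro!: exI[of _ "\<lambda>p. p \<phi>"])

text \<open>Such a coordinate is 0 at every evaluated point and hence on their closure. It follows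
  that points are separated by coordinates from \<open>R\<close> alone.\<close>

lemma evaluation_outside:
  assumes R: "compactification (evaluation_space R, evaluation R)"
    and "p \<in> topspace (evaluation_space R)" "\<phi> \<notin> R"
  shows "p \<phi> = 0"
  using compactification_eqI[OF R Hausdorff_space_euclidean continuous_map_evaluation_space[of R \<phi>] _ _ assms(2),
      of "\<lambda>_. 0"] assms(3)
  by (simp add: evaluation_def)

lemma evaluation_separating:
  assumes R: "compactification (evaluation_space R, evaluation R)"
    and "p \<in> topspace (evaluation_space R)" "q \<in> topspace (evaluation_space R)" "p \<noteq> q"
  shows "\<exists>\<phi>\<in>R. p \<phi> \<noteq> q \<phi>"
proof -
  obtain \<phi> where \<phi>: "p \<phi> \<noteq> q \<phi>" using assms(4) by blast
  have "\<phi> \<in> R"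
  proof (rule ccontr)
    assume "\<phi> \<notin> R"
    with \<phi> show False by (simp add: evaluation_outside[OF R assms(2)] evaluation_outside[OF R assms(3)])
  qed
  with \<phi> show ?thesis by (rule bexI)
qed

text \<open>The coordinates from \<open>R\<close> separate the points of the evaluation space, and
  each has a counterpart on \<open>L\<close>. This minimality is what makes joint evaluation spaces
  least upper bounds.\<close>

lemma evaluation_space_le:
  assumes R: "compactification (evaluation_space R, evaluation R)"
    and L: "compactification (L, g)" and sub: "R \<subseteq> extendable_functions (L, g)"
  shows "cpt_le (evaluation_space R, evaluation R) (L, g)"
proof -
  have "\<forall>\<phi>\<in>R. \<exists>G. continuous_map L euclideanreal G \<and> (\<forall>n. G (g n) = \<phi> n)"
  proof
    fix \<phi> assume "\<phi> \<in> R"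
    with sub have "\<phi> \<in> extendable_functions (L, g)" by blast
    then show "\<exists>G. continuous_map L euclideanreal G \<and> (\<forall>n. G (g n) = \<phi> n)" by simp
  qed
  then obtain G where "\<And>\<phi>. \<phi> \<in> R \<Longrightarrow> continuous_map L euclideanreal (G \<phi>)"
    "\<And>\<phi> n. \<phi> \<in> R \<Longrightarrow> G \<phi> (g n) = \<phi> n" by metis
  then show ?thesis
    by (intro cpt_leI[OF R L, of R "\<lambda>\<phi> p. p \<phi>" G])
      (simp_all add: continuous_map_evaluation_space evaluation_def evaluation_separating[OF R])
qed

section \<open>The Stone-Cech compactification\<close>

lemma bounded_indicator: "bounded (range (indicator A :: nat \<Rightarrow> real))"
  by (rule bounded_subset[of "{0, 1}"]) (auto simp: indicator_def)

lemma Stone_Cech_compactification: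
  shows "compactification Stone_Cech" and "compactification (A :: cpt) \<Longrightarrow> cpt_le A Stone_Cech"
proof -
  define R :: "(nat \<Rightarrow> real) set" where "R = {\<phi>. bounded (range \<phi>)}"
  have R: "compactification (evaluation_space R, evaluation R)"
    by (rule compactification_evaluation) (auto simp: R_def bounded_indicator)
  have "cpt_le A (evaluation_space R, evaluation R)" if "compactification A" for A :: cpt
  proof -
    obtain K e where A: "A = (K, e)" by (rule prod.exhaust)
    have "extendable_functions (K, e) \<subseteq> R" by (auto simp: R_def)
    also have "\<dots> \<subseteq> extendable_functions (evaluation_space R, evaluation R)"
      using extendable_evaluation[of _ R] unfolding R_def by blast
    finally show ?thesis
      using cpt_le_if_extendable_subset[OF _ R] that unfolding A by blast
  qed
  with R have "\<exists>B :: cpt. compactification B \<and> (\<forall>A :: cpt. compactification A \<longrightarrow> cpt_le A B)"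
    by (intro exI[of _ "(evaluation_space R, evaluation R)"] conjI allI impI)
  from someI_ex[OF this, folded Stone_Cech_def]
  show "compactification Stone_Cech" "compactification A \<Longrightarrow> cpt_le A Stone_Cech"
    by (blast, blast)
qed

text \<open>\<open>Stone_Cech\<close> is a chosen object known only by its maximality, so it is
  compared with the concrete evaluation space of all bounded functions.\<close>

lemma extendable_Stone_Cech:
  assumes "bounded (range \<phi>)"
  shows "\<phi> \<in> extendable_functions Stone_Cech"
proof -
  define R :: "(nat \<Rightarrow> real) set" where "R = {\<phi>. bounded (range \<phi>)}"
  have R: "compactification (evaluation_space R, evaluation R)"
    by (rule compactification_evaluation) (auto simp: R_def bounded_indicator)
  have "\<phi> \<in> extendable_functions (evaluation_space R, evaluation R)"
    using extendable_evaluation[of \<phi> R] assms by (simp add: R_def del: extendable_functions.simps)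
  then show ?thesis
    using extendable_mono[OF Stone_Cech_compactification(2)[OF R]] by blast
qed

text \<open>Two-valued functions already separate the points of \<beta>\<omega>: given disjoint open
  \<open>U\<close> and \<open>V\<close> around \<open>p\<close> and \<open>q\<close>, extend the
  characteristic function of the trace of \<open>U\<close> on \<omega>. If all these functions
  extend over \<open>B\<close> as well, \<open>cpt_leI\<close> applies.\<close>

lemma cpt_equiv_Stone_Cech_iff:
  fixes B :: cpt
  assumes B: "compactification B"
  shows "cpt_equiv Stone_Cech B \<longleftrightarrow> (\<forall>A. indicator A \<in> extendable_functions B)"
proof -
  obtain K e where SC: "Stone_Cech = (K, e)" by (rule prod.exhaust)
  obtain L g where Lg: "B = (L, g)" by (rule prod.exhaust)
  have K: "compactification (K, e)" and L: "compactification (L, g)"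
    using Stone_Cech_compactification(1) SC B Lg by metis+
  have le: "cpt_le (L, g) (K, e)" using Stone_Cech_compactification(2)[of B] SC B Lg by metis
  show ?thesis
  proof
    assume "cpt_equiv Stone_Cech B"
    then show "\<forall>A. indicator A \<in> extendable_functions B"
      using extendable_mono[OF cpt_equiv_imp_le] extendable_Stone_Cech[OF bounded_indicator] SC Lg
      by (metis subsetD)
  next
    assume A: "\<forall>A. indicator A \<in> extendable_functions B"
    define I where "I = {(F, G). continuous_map K euclideanreal F \<and>
      continuous_map L euclideanreal G \<and> (\<forall>n. F (e n) = G (g n))}"
    have "cpt_le (K, e) (L, g)"
    proof (rule cpt_leI[OF K L, of I fst snd])
      fix p q assume pq: "p \<in> topspace K" "q \<in> topspace K" "p \<noteq> q"
      then obtain U V where UV: "openin K U" "openin K V" "p \<in> U" "q \<in> V" "U \<inter> V = {}"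
        using K unfolding compactification.simps Hausdorff_space_def disjnt_def by metis
      define A where "A = e -` U"
      obtain F where F: "continuous_map K euclideanreal F" "\<And>n. F (e n) = indicator A n"
        using extendable_Stone_Cech[OF bounded_indicator, of A] SC
        by (metis extendable_functionsE)
      obtain G where G: "continuous_map L euclideanreal G" "\<And>n. G (g n) = indicator A n"
        using A[rule_format, of "e -` U"] Lg unfolding A_def by (metis extendable_functionsE)
      \<comment> \<open>Otherwise the open set where \<open>F\<close> differs from 1 meets
        \<open>U\<close> in some \<open>e n\<close>, although \<open>n\<close> belongs to
        \<open>A\<close>. The value at \<open>q\<close> is found in the same way inside
        \<open>V\<close>.\<close>
      have "F p = 1"
      proof (rule ccontr)
        assume "F p \<noteq> 1"
        then have "p \<in> U \<inter> {x \<in> topspace K. F x \<in> - {1}}" using UV pq by auto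
        moreover have "openin K (U \<inter> {x \<in> topspace K. F x \<in> - {1}})"
          using UV openin_continuous_map_preimage[OF F(1), of "-{1}"] by auto
        ultimately obtain n where "e n \<in> U" "F (e n) \<noteq> 1"
          using compactification_dense[OF K] by blast
        then show False by (simp add: F(2) A_def)
      qed
      moreover have "F q = 0"
      proof (rule ccontr)
        assume "F q \<noteq> 0"
        then have "q \<in> V \<inter> {x \<in> topspace K. F x \<in> - {0}}" using UV pq by auto
        moreover have "openin K (V \<inter> {x \<in> topspace K. F x \<in> - {0}})"
          using UV openin_continuous_map_preimage[OF F(1), of "-{0}"] by auto
        ultimately obtain n where "e n \<in> V" "F (e n) \<noteq> 0"
          using compactification_dense[OF K] by blast
        then show False
          using UV(5) by (auto simp: F(2) A_def indicator_def split: if_splits)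
      qed
      moreover have "(F, G) \<in> I" using F G by (auto simp: I_def)
      ultimately show "\<exists>i\<in>I. fst i p \<noteq> fst i q" by force
    qed (auto simp: I_def)
    then show "cpt_equiv Stone_Cech B"
      unfolding SC Lg by (rule cpt_equivI[OF K L _ le])
  qed
qed

section \<open>Smirnov compactifications and their suprema\<close>

lemma discrete_metric_isolated:
  assumes "d \<in> discrete_metrics"
  shows "\<exists>r>0. \<forall>y. mdist d n y < r \<longrightarrow> y = n"
proof -
  interpret Metric_space "mspace d" "mdist d" by simp
  have "openin mtopology {n}" and sp: "mspace d = UNIV"
    using assms by (auto simp: discrete_metrics_def mtopology_of_def)
  then obtain r where r: "r > 0" "mball n r \<subseteq> {n}"
    unfolding openin_mtopology by blast
  have "y = n" if "mdist d n y < r" for y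
  proof -
    have "y \<in> mball n r" by (rule in_mball[THEN iffD2]) (simp add: sp that)
    with r(2) show ?thesis by blast
  qed
  with r(1) show ?thesis by blast
qed

lemma bounded_uniformly_continuous_iff:
  assumes "d \<in> discrete_metrics"
  shows "\<phi> \<in> bounded_uniformly_continuous d \<longleftrightarrow> bounded (range \<phi>) \<and>
    (\<forall>\<epsilon>>0. \<exists>\<delta>>0. \<forall>x y. mdist d x y < \<delta> \<longrightarrow> \<bar>\<phi> x - \<phi> y\<bar> < \<epsilon>)"
proof -
  have "(\<forall>x y. mdist d y x < \<delta> \<longrightarrow> \<bar>\<phi> y - \<phi> x\<bar> < \<epsilon>) \<longleftrightarrow>
      (\<forall>x y. mdist d x y < \<delta> \<longrightarrow> \<bar>\<phi> x - \<phi> y\<bar> < \<epsilon>)" for \<delta> \<epsilon>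
    by (rule all_comm)
  with assms show ?thesis
    by (simp add: bounded_uniformly_continuous_def uniformly_continuous_map_def
        discrete_metrics_def dist_real_def)
qed

lemma indicator_bounded_uniformly_continuous:
  assumes d: "d \<in> discrete_metrics"
  shows "indicator {n} \<in> bounded_uniformly_continuous d"
proof -
  obtain r where r: "r > 0" "\<And>y. mdist d n y < r \<Longrightarrow> y = n"
    using discrete_metric_isolated[OF d] by blast
  have "\<bar>indicator {n} x - indicator {n} y :: real\<bar> < \<epsilon>" if "\<epsilon> > 0" "mdist d x y < r" for \<epsilon> x y
  proof -
    have "x = n \<longleftrightarrow> y = n" using r(2)[of x] r(2)[of y] that(2) by (auto simp: mdist_commute)
    with that show ?thesis by (auto simp: indicator_def)
  qed
  with r show ?thesis
    by (auto simp: bounded_uniformly_continuous_iff[OF d] bounded_indicator)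
qed

text \<open>The distance to \<open>P\<close>, divided by \<epsilon> and truncated at 1, is Lipschitz
  with constant 1/\<epsilon>. Empty \<open>P\<close> is treated apart because the infimum would then
  range over nothing.\<close>

lemma metric_Urysohn:
  assumes d: "d \<in> discrete_metrics" and "\<epsilon> > 0"
    and far: "\<And>x y. \<lbrakk>x \<in> P; y \<in> Q\<rbrakk> \<Longrightarrow> \<epsilon> \<le> mdist d x y"
  obtains \<phi> where "\<phi> \<in> bounded_uniformly_continuous d"
    "\<And>x. x \<in> P \<Longrightarrow> \<phi> x = 0" "\<And>y. y \<in> Q \<Longrightarrow> \<phi> y = 1"
proof (cases "P = {}")
  case True
  then show ?thesis
    using that[of "\<lambda>_. 1"] by (auto simp: bounded_uniformly_continuous_iff[OF d] intro: exI[of _ 1])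
next
  case False
  have sp: "mspace d = UNIV" using d by (simp add: discrete_metrics_def)
  define \<rho> where "\<rho> x = (INF p\<in>P. mdist d x p)" for x
  have bdd: "bdd_below (mdist d x ` P)" for x
    by (rule bdd_belowI[of _ 0]) auto
  have nonneg: "0 \<le> \<rho> x" for x
    unfolding \<rho>_def using False by (auto intro: cINF_greatest)
  have lip: "\<rho> x \<le> mdist d x y + \<rho> y" for x y
  proof -
    have "\<rho> x - mdist d x y \<le> \<rho> y"
      unfolding \<rho>_def[of y]
    proof (rule cINF_greatest[OF False])
      fix p assume "p \<in> P"
      then have "\<rho> x \<le> mdist d x p" unfolding \<rho>_def by (rule cINF_lower[OF bdd])
      also have "\<dots> \<le> mdist d x y + mdist d y p" by (rule mdist_triangle) (auto simp: sp)
      finally show "\<rho> x - mdist d x y \<le> mdist d y p" by simp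
    qed
    then show ?thesis by simp
  qed
  define \<phi> where "\<phi> x = min 1 (\<rho> x / \<epsilon>)" for x
  have \<phi>_lip: "\<bar>\<phi> x - \<phi> y\<bar> \<le> mdist d x y / \<epsilon>" for x y
  proof -
    have "\<rho> x / \<epsilon> \<le> mdist d x y / \<epsilon> + \<rho> y / \<epsilon>" "\<rho> y / \<epsilon> \<le> mdist d x y / \<epsilon> + \<rho> x / \<epsilon>"
      using lip[of x y] lip[of y x] \<open>\<epsilon> > 0\<close>
      by (simp_all add: mdist_commute field_simps)
    then show ?thesis
      unfolding \<phi>_def by linarith
  qed
  show ?thesis
  proof (rule that)
    have "bounded (range \<phi>)"
      unfolding bounded_iff by (rule exI[of _ 1]) (use nonneg \<open>\<epsilon> > 0\<close> in \<open>auto simp: \<phi>_def\<close>)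
    moreover have "\<bar>\<phi> x - \<phi> y\<bar> < \<eta>" if "mdist d x y < \<eta> * \<epsilon>" for x y \<eta>
      using \<phi>_lip[of x y] that \<open>\<epsilon> > 0\<close> by (smt (verit) pos_divide_less_eq)
    ultimately show "\<phi> \<in> bounded_uniformly_continuous d"
      unfolding bounded_uniformly_continuous_iff[OF d] using \<open>\<epsilon> > 0\<close> by (meson mult_pos_pos)
  next
    fix x assume "x \<in> P"
    then have "\<rho> x \<le> mdist d x x"
      unfolding \<rho>_def by (rule cINF_lower[OF bdd])
    moreover have "mdist d x x = 0" by (simp add: sp)
    ultimately show "\<phi> x = 0" using nonneg[of x] by (simp add: \<phi>_def)
  next
    fix y assume "y \<in> Q"
    then have "\<epsilon> \<le> \<rho> y"
      unfolding \<rho>_def by (intro cINF_greatest[OF False]) (auto simp: mdist_commute[of d y] far)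
    then show "\<phi> y = 1" using \<open>\<epsilon> > 0\<close> by (simp add: \<phi>_def)
  qed
qed

text \<open>Compactness reduces the separation of the pairs in \<open>Z\<close> to finitely many coordinates.\<close>

lemma evaluation_finitely_many:
  assumes R: "compactification (evaluation_space R, evaluation R)"
    and Z: "closedin (prod_topology (evaluation_space R) (evaluation_space R)) Z"
    and neq: "\<And>p. (p, p) \<notin> Z"
  obtains J where "finite J" "\<And>\<phi> c \<epsilon>. (\<phi>, c, \<epsilon>) \<in> J \<Longrightarrow> \<phi> \<in> R \<and> \<epsilon> > 0"
    "\<And>m n. (evaluation R m, evaluation R n) \<in> Z \<Longrightarrow>
       \<exists>(\<phi>, c, \<epsilon>)\<in>J. \<bar>\<phi> m - c\<bar> < \<epsilon> \<and> 2 * \<epsilon> < \<bar>\<phi> n - c\<bar>"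
proof -
  define K where "K = evaluation_space R"
  define e where "e = evaluation R"
  \<comment> \<open>The gap between \<epsilon> and 2\<epsilon> forces \<phi> to differ by more than
    \<epsilon> at the two points, a bound that is uniform over the whole open set.\<close>
  define V where "V = (\<lambda>(\<phi>, c, \<epsilon>). {z \<in> topspace (prod_topology K K).
    \<bar>fst z \<phi> - c\<bar> < \<epsilon>} \<inter> {z \<in> topspace (prod_topology K K). 2 * \<epsilon> < \<bar>snd z \<phi> - c\<bar>})"
  define I where "I = {(\<phi>, c::real, \<epsilon>::real). \<phi> \<in> R \<and> \<epsilon> > 0}"
  note cont = continuous_map_evaluation_space[of R, folded K_def]
  have c1: "continuous_map (prod_topology K K) euclideanreal (\<lambda>z. \<bar>fst z \<phi> - c\<bar>)" for \<phi> c
    by (intro continuous_map_real_abs continuous_map_diff continuous_map_const[THEN iffD2]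
        continuous_map_compose[OF continuous_map_fst cont, unfolded o_def]) auto
  have c2: "continuous_map (prod_topology K K) euclideanreal (\<lambda>z. \<bar>snd z \<phi> - c\<bar>)" for \<phi> c
    by (intro continuous_map_real_abs continuous_map_diff continuous_map_const[THEN iffD2]
        continuous_map_compose[OF continuous_map_snd cont, unfolded o_def]) auto
  have V: "openin (prod_topology K K) (V i)" for i
  proof -
    obtain \<phi> c \<epsilon> where "i = (\<phi>, c, \<epsilon>)" by (metis prod_cases3)
    then show ?thesis
      using openin_continuous_map_preimage[OF c1, of "{..<\<epsilon>}" \<phi> c]
        openin_continuous_map_preimage[OF c2, of "{2*\<epsilon><..}" \<phi> c]
      by (auto simp: V_def)
  qed
  have ZK: "Z \<subseteq> topspace (prod_topology K K)"
    using Z closedin_subset unfolding K_def by blast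
  have "Z \<subseteq> \<Union>(V ` I)"
  proof
    fix z assume z: "z \<in> Z"
    obtain p q where zpq: "z = (p, q)" by (rule prod.exhaust)
    have pq: "p \<in> topspace K" "q \<in> topspace K" using z ZK zpq by auto
    have "p \<noteq> q" using z zpq neq by auto
    then obtain \<phi> where \<phi>: "\<phi> \<in> R" "p \<phi> \<noteq> q \<phi>"
      using evaluation_separating[OF R, of p q] pq unfolding K_def by (elim bexE meta_impE) auto
    \<comment> \<open>Centre the condition at the value in \<open>p\<close>; with a third of the
      difference as radius, the value in \<open>q\<close> lies beyond twice the radius.\<close>
    have "z \<in> V (\<phi>, p \<phi>, \<bar>q \<phi> - p \<phi>\<bar> / 3)"
      using pq \<phi>(2) by (simp add: V_def zpq)
    moreover have "(\<phi>, p \<phi>, \<bar>q \<phi> - p \<phi>\<bar> / 3) \<in> I" using \<phi> by (auto simp: I_def)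
    ultimately show "z \<in> \<Union>(V ` I)" by blast
  qed
  moreover have "compactin (prod_topology K K) Z"
    using Z R by (auto simp: K_def intro!: closedin_compact_space simp: compact_space_prod_topology)
  ultimately obtain \<F> where \<F>: "finite \<F>" "\<F> \<subseteq> V ` I" "Z \<subseteq> \<Union>\<F>"
    using compactinD[of "prod_topology K K" Z "V ` I"] V by blast
  obtain J where J: "finite J" "J \<subseteq> I" "Z \<subseteq> \<Union>(V ` J)"
    using finite_subset_image[OF \<F>(1,2)] \<F>(3) by blast
  show ?thesis
  proof (rule that[OF J(1)])
    show "\<phi> \<in> R \<and> \<epsilon> > 0" if "(\<phi>, c, \<epsilon>) \<in> J" for \<phi> c \<epsilon>
      using that J by (auto simp: I_def)
    fix m n assume "(evaluation R m, evaluation R n) \<in> Z"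
    then obtain \<phi> c \<epsilon> where j: "(\<phi>, c, \<epsilon>) \<in> J" and v: "(e m, e n) \<in> V (\<phi>, c, \<epsilon>)"
      using J(3) by (auto simp: e_def)
    moreover have "\<phi> \<in> R" using j J by (auto simp: I_def)
    ultimately show "\<exists>(\<phi>, c, \<epsilon>)\<in>J. \<bar>\<phi> m - c\<bar> < \<epsilon> \<and> 2 * \<epsilon> < \<bar>\<phi> n - c\<bar>"
      by (intro bexI[OF _ j]) (auto simp: V_def e_def evaluation_def)
  qed
qed

text \<open>The evaluation space of the uniformly continuous functions witnesses the choice in
  \<open>Smirnov\<close>. The point is that no further functions extend over it: by compactness,
  finitely many uniformly continuous functions control the oscillation of an extendable one.\<close>

lemma Smirnov_compactification:
  assumes d: "d \<in> discrete_metrics"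
  shows "compactification (Smirnov d)"
    and "extendable_functions (Smirnov d) = bounded_uniformly_continuous d"
proof -
  define R where "R = bounded_uniformly_continuous d"
  define K where "K = evaluation_space R"
  define e where "e = evaluation R"
  have bd: "\<And>\<phi>. \<phi> \<in> R \<Longrightarrow> bounded (range \<phi>)"
    by (auto simp: R_def bounded_uniformly_continuous_def)
  have R: "compactification (evaluation_space R, evaluation R)"
    by (rule compactification_evaluation[OF bd])
      (simp_all add: R_def indicator_bounded_uniformly_continuous[OF d])
  have "extendable_functions (K, e) \<subseteq> R"
  proof
    fix \<phi> assume \<phi>: "\<phi> \<in> extendable_functions (K, e)"
    then obtain F where F: "continuous_map K euclideanreal F" "\<And>n. F (e n) = \<phi> n"
      by (rule extendable_functionsE) blast
    have "\<exists>\<delta>>0. \<forall>x y. mdist d x y < \<delta> \<longrightarrow> \<bar>\<phi> x - \<phi> y\<bar> < \<eta>" if "\<eta> > 0" for \<eta>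
    proof -
      define Z where "Z = {z \<in> topspace (prod_topology K K). \<bar>F (fst z) - F (snd z)\<bar> \<in> {\<eta>..}}"
      have "closedin (prod_topology K K) Z"
        unfolding Z_def
        by (intro closedin_continuous_map_preimage[of _ euclideanreal] continuous_map_real_abs continuous_map_diff
            continuous_map_compose[OF continuous_map_fst F(1), unfolded o_def]
            continuous_map_compose[OF continuous_map_snd F(1), unfolded o_def]) auto
      moreover have "\<And>p. (p, p) \<notin> Z" using \<open>\<eta> > 0\<close> by (auto simp: Z_def)
      ultimately obtain J where J: "finite J" "\<And>\<phi> c \<epsilon>. (\<phi>, c, \<epsilon>) \<in> J \<Longrightarrow> \<phi> \<in> R \<and> \<epsilon> > 0"
        "\<And>m n. (e m, e n) \<in> Z \<Longrightarrow>
          \<exists>(\<phi>, c, \<epsilon>)\<in>J. \<bar>\<phi> m - c\<bar> < \<epsilon> \<and> 2 * \<epsilon> < \<bar>\<phi> n - c\<bar>"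
        using evaluation_finitely_many[OF R, of Z] unfolding K_def e_def by blast
      have "\<forall>j\<in>J. \<exists>\<delta>>0. \<forall>x y. mdist d x y < \<delta> \<longrightarrow> \<bar>fst j x - fst j y\<bar> < snd (snd j)"
        using J(2) by (auto simp: R_def bounded_uniformly_continuous_iff[OF d])
      then obtain \<delta> where \<delta>: "\<And>j. j \<in> J \<Longrightarrow> \<delta> j > 0"
        "\<And>j x y. \<lbrakk>j \<in> J; mdist d x y < \<delta> j\<rbrakk> \<Longrightarrow> \<bar>fst j x - fst j y\<bar> < snd (snd j)"
        by metis
      \<comment> \<open>The element 1 keeps the minimum meaningful when \<open>J\<close> is
        empty.\<close>
      define \<delta>0 where "\<delta>0 = Min (insert 1 (\<delta> ` J))"
      have "\<delta>0 > 0" using J(1) \<delta>(1) by (auto simp: \<delta>0_def)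
      moreover have "\<bar>\<phi> x - \<phi> y\<bar> < \<eta>" if xy: "mdist d x y < \<delta>0" for x y
      proof (rule ccontr)
        assume "\<not> \<bar>\<phi> x - \<phi> y\<bar> < \<eta>"
        then have "(e x, e y) \<in> Z"
          using compactification_range[OF R] F(2) by (auto simp: Z_def K_def e_def)
        then obtain \<psi> c \<epsilon> where j: "(\<psi>, c, \<epsilon>) \<in> J" "\<bar>\<psi> x - c\<bar> < \<epsilon>" "2 * \<epsilon> < \<bar>\<psi> y - c\<bar>"
          using J(3) by blast
        have "\<delta>0 \<le> \<delta> (\<psi>, c, \<epsilon>)" using j(1) J(1) by (auto simp: \<delta>0_def)
        \<comment> \<open>Together with the bound \<epsilon> at \<open>x\<close>, this keeps \<psi>
          at \<open>y\<close> within 2\<epsilon> of \<open>c\<close>, contrary to the choice of the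
          triple.\<close>
        then have "\<bar>\<psi> x - \<psi> y\<bar> < \<epsilon>" using \<delta>(2)[OF j(1)] xy by force
        with j show False by linarith
      qed
      ultimately show ?thesis by blast
    qed
    with \<phi> show "\<phi> \<in> R"
      by (auto simp: R_def bounded_uniformly_continuous_iff[OF d])
  qed
  moreover have "R \<subseteq> extendable_functions (K, e)"
    using extendable_evaluation bd unfolding K_def e_def by blast
  ultimately have "\<exists>A :: cpt. compactification A \<and>
      extendable_functions A = bounded_uniformly_continuous d"
    using R unfolding K_def e_def R_def by blast
  from someI_ex[OF this, folded Smirnov_def]
  show "compactification (Smirnov d)" "extendable_functions (Smirnov d) = bounded_uniformly_continuous d"
    by blast+
qed

section \<open>Suprema of Smirnov compactifications\<close>

definition joint_functions :: "nat metric set \<Rightarrow> (nat \<Rightarrow> real) set" where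
  "joint_functions D = (\<Union>d\<in>D. bounded_uniformly_continuous d)"

text \<open>A concrete model of the supremum for nonempty \<open>D\<close>; generating it from the
  plain union of the rings avoids describing the closed ring that they generate.\<close>

definition joint_cpt :: "nat metric set \<Rightarrow> cpt" where
  "joint_cpt D = (evaluation_space (joint_functions D), evaluation (joint_functions D))"

lemma joint_functions_bounded: "\<phi> \<in> joint_functions D \<Longrightarrow> bounded (range \<phi>)"
  by (auto simp: joint_functions_def bounded_uniformly_continuous_def)

lemma compactification_joint:
  assumes "D \<subseteq> discrete_metrics" "D \<noteq> {}"
  shows "compactification (joint_cpt D)"
  unfolding joint_cpt_def
proof (rule compactification_evaluation[OF joint_functions_bounded])
  show "indicator {n} \<in> joint_functions D" for n
    using assms indicator_bounded_uniformly_continuous unfolding joint_functions_def by blast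
qed

text \<open>It is an upper bound because every generator extends over it, and the least one by
  \<open>evaluation_space_le\<close>.\<close>

lemma cpt_is_sup_joint:
  assumes D: "D \<subseteq> discrete_metrics" "D \<noteq> {}"
  shows "cpt_is_sup (Smirnov ` D) (joint_cpt D)"
  unfolding cpt_is_sup_def
proof (intro conjI ballI allI impI)
  note R = compactification_joint[OF D, unfolded joint_cpt_def]
  show "compactification (joint_cpt D)" by (rule compactification_joint[OF D])
  show "cpt_le A (joint_cpt D)" if A: "A \<in> Smirnov ` D" for A
  proof -
    obtain d where d: "d \<in> D" "A = Smirnov d" using A by blast
    obtain K e where Ke: "A = (K, e)" by (rule prod.exhaust)
    have K: "compactification (K, e)" "extendable_functions (K, e) = bounded_uniformly_continuous d"
      using Smirnov_compactification[of d] d D Ke by auto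
    have "bounded_uniformly_continuous d \<subseteq> joint_functions D"
      using d by (auto simp: joint_functions_def)
    then have "extendable_functions (K, e) \<subseteq> extendable_functions (joint_cpt D)"
      unfolding K(2) joint_cpt_def using extendable_evaluation joint_functions_bounded by blast
    then show ?thesis
      unfolding Ke joint_cpt_def by (rule cpt_le_if_extendable_subset[OF K(1) R])
  qed
  show "cpt_le (joint_cpt D) C" if C: "compactification C \<and> (\<forall>A\<in>Smirnov ` D. cpt_le A C)" for C :: cpt
  proof -
    obtain L g where Lg: "C = (L, g)" by (rule prod.exhaust)
    have "bounded_uniformly_continuous d \<subseteq> extendable_functions (L, g)" if "d \<in> D" for d
      using extendable_mono[of "Smirnov d" C] Smirnov_compactification(2)[of d] that C D
      unfolding Lg by blast
    then show ?thesis
      unfolding joint_cpt_def Lg using C Lg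
      by (intro evaluation_space_le[OF R]) (auto simp: joint_functions_def)
  qed
qed

lemma cpt_equiv_sup_iff:
  assumes D: "D \<subseteq> discrete_metrics" "D \<noteq> {}"
  shows "cpt_equiv Stone_Cech (cpt_sup (Smirnov ` D)) \<longleftrightarrow>
    (\<forall>A. indicator A \<in> extendable_functions (joint_cpt D))"
proof -
  have J: "cpt_is_sup (Smirnov ` D) (joint_cpt D)" by (rule cpt_is_sup_joint[OF D])
  then have S: "cpt_is_sup (Smirnov ` D) (cpt_sup (Smirnov ` D))"
    unfolding cpt_sup_def by (rule someI)
  \<comment> \<open>The chosen supremum and the concrete one lie below each other, so the same
    functions extend over both.\<close>
  have "cpt_le (joint_cpt D) (cpt_sup (Smirnov ` D))" "cpt_le (cpt_sup (Smirnov ` D)) (joint_cpt D)"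
    using J S unfolding cpt_is_sup_def by blast+
  then have "extendable_functions (joint_cpt D) = extendable_functions (cpt_sup (Smirnov ` D))"
    by (intro subset_antisym extendable_mono)
  then show ?thesis
    using cpt_equiv_Stone_Cech_iff S unfolding cpt_is_sup_def by metis
qed

section \<open>Sets with clopen closure in a supremum\<close>

text \<open>This is the algebra \<open>S D\<close> of the introduction as a subset of the Cantor
  space; its members are the sets with clopen closure in the supremum.\<close>

definition clopen_traces :: "nat metric set \<Rightarrow> (nat \<Rightarrow> bool) set" where
  "clopen_traces D = {X. (\<lambda>n. of_bool (X n)) \<in> extendable_functions (joint_cpt D)}"

text \<open>Metrics are listed with possible repetition, because several pairs may need the same
  metric; one bound \<open>1 / Suc m\<close> serves all pairs. Fixing both parameters is what makes
  the set closed.\<close>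

definition separated_traces :: "nat metric list \<Rightarrow> nat \<Rightarrow> (nat \<Rightarrow> bool) set" where
  "separated_traces ds m = {X. \<exists>P Q :: nat \<Rightarrow> nat \<Rightarrow> bool. \<forall>x y.
     (\<forall>i<length ds. P i x \<and> Q i y \<longrightarrow> 1 / Suc m \<le> mdist (ds ! i) x y) \<and>
     (X x \<and> \<not> X y \<longrightarrow> (\<exists>i<length ds. P i x \<and> Q i y))}"

lemma clopen_traces_UNIV_iff:
  "clopen_traces D = UNIV \<longleftrightarrow> (\<forall>A. indicator A \<in> extendable_functions (joint_cpt D))"
proof
  assume *: "clopen_traces D = UNIV"
  show "\<forall>A. indicator A \<in> extendable_functions (joint_cpt D)"
  proof
    fix A :: "nat set"
    have "(\<lambda>n. n \<in> A) \<in> clopen_traces D" using * by simp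
    then show "indicator A \<in> extendable_functions (joint_cpt D)"
      unfolding clopen_traces_def mem_Collect_eq indicator_def .
  qed
next
  assume *: "\<forall>A. indicator A \<in> extendable_functions (joint_cpt D)"
  have "X \<in> clopen_traces D" for X
    using *[rule_format, of "{n. X n}"] unfolding clopen_traces_def mem_Collect_eq indicator_def .
  then show "clopen_traces D = UNIV" by blast
qed

lemma cpt_equiv_sup_iff_traces:
  assumes "D \<subseteq> discrete_metrics" "D \<noteq> {}"
  shows "cpt_equiv Stone_Cech (cpt_sup (Smirnov ` D)) \<longleftrightarrow> clopen_traces D = UNIV"
  using cpt_equiv_sup_iff[OF assms] clopen_traces_UNIV_iff by blast

text \<open>Compactness is applied to the pairs of points at which the extended characteristic
  function drops from 1 to 0. The finitely many functions obtained turn into pairs of sets at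
  positive distance.\<close>

lemma clopen_traces_imp_separated:
  assumes D: "D \<subseteq> discrete_metrics" "D \<noteq> {}" and X: "X \<in> clopen_traces D"
  obtains ds m where "ds \<in> lists D" "X \<in> separated_traces ds m"
proof -
  define R where "R = joint_functions D"
  define K where "K = evaluation_space R"
  define e where "e = evaluation R"
  have R: "compactification (evaluation_space R, evaluation R)"
    using compactification_joint[OF D] unfolding joint_cpt_def R_def .
  have "(\<lambda>n. of_bool (X n)) \<in> extendable_functions (K, e)"
    using X unfolding clopen_traces_def joint_cpt_def K_def e_def R_def by blast
  then obtain F where F: "continuous_map K euclideanreal F" "\<And>n. F (e n) = of_bool (X n)"
    by (rule extendable_functionsE) blast
  define Z where "Z = {z \<in> topspace (prod_topology K K). F (fst z) - F (snd z) \<in> {1}}"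
  have "closedin (prod_topology K K) Z"
    unfolding Z_def
    by (intro closedin_continuous_map_preimage[of _ euclideanreal] continuous_map_diff
        continuous_map_compose[OF continuous_map_fst F(1), unfolded o_def]
        continuous_map_compose[OF continuous_map_snd F(1), unfolded o_def]) auto
  moreover have "\<And>p. (p, p) \<notin> Z" by (auto simp: Z_def)
  ultimately obtain J where J: "finite J" "\<And>\<phi> c \<epsilon>. (\<phi>, c, \<epsilon>) \<in> J \<Longrightarrow> \<phi> \<in> R \<and> \<epsilon> > 0"
    "\<And>m n. (e m, e n) \<in> Z \<Longrightarrow>
      \<exists>(\<phi>, c, \<epsilon>)\<in>J. \<bar>\<phi> m - c\<bar> < \<epsilon> \<and> 2 * \<epsilon> < \<bar>\<phi> n - c\<bar>"
    using evaluation_finitely_many[OF R, of Z] unfolding K_def e_def by blast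
  obtain js where js: "set js = J" using finite_list[OF J(1)] by blast
  have "\<exists>d\<in>D. \<exists>k. \<forall>x y. mdist d x y < 1 / Suc k \<longrightarrow> \<bar>fst j x - fst j y\<bar> < snd (snd j)"
    if "j \<in> J" for j
  proof -
    obtain \<phi> c \<epsilon> where j: "j = (\<phi>, c, \<epsilon>)" by (rule prod_cases3)
    have "\<phi> \<in> R" "\<epsilon> > 0" using J(2) that unfolding j by blast+
    then obtain d where d: "d \<in> D" "\<phi> \<in> bounded_uniformly_continuous d"
      unfolding R_def joint_functions_def by blast
    then have "\<exists>\<delta>>0. \<forall>x y. mdist d x y < \<delta> \<longrightarrow> \<bar>\<phi> x - \<phi> y\<bar> < \<epsilon>"
      using bounded_uniformly_continuous_iff[of d \<phi>] D(1) \<open>\<epsilon> > 0\<close> by blast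
    then obtain \<delta> where \<delta>: "\<delta> > 0" "\<forall>x y. mdist d x y < \<delta> \<longrightarrow> \<bar>\<phi> x - \<phi> y\<bar> < \<epsilon>"
      by blast
    obtain k where "1 / Suc k < \<delta>" using nat_approx_posE[OF \<delta>(1)] by blast
    with \<delta>(2) d(1) show ?thesis
      by (intro bexI[of _ d] exI[of _ k]) (simp_all add: j)
  qed
  then obtain d k where dk: "\<And>j. j \<in> J \<Longrightarrow> d j \<in> D"
    "\<And>j x y. \<lbrakk>j \<in> J; mdist (d j) x y < 1 / Suc (k j)\<rbrakk> \<Longrightarrow> \<bar>fst j x - fst j y\<bar> < snd (snd j)"
    by metis
  \<comment> \<open>The largest index gives the smallest distance, so a single bound works for all
    of \<open>J\<close>.\<close>
  define m where "m = Max (insert 0 (k ` J))"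
  have m: "k j \<le> m" if "j \<in> J" for j
    using J(1) that by (simp add: m_def)
  \<comment> \<open>Across \<open>P i\<close> and \<open>Q i\<close> the function differs by more
    than its \<epsilon>, so uniform continuity keeps the two sets apart.\<close>
  define P where "P i x \<longleftrightarrow> \<bar>fst (js ! i) x - fst (snd (js ! i))\<bar> < snd (snd (js ! i))" for i x
  define Q where "Q i y \<longleftrightarrow> 2 * snd (snd (js ! i)) < \<bar>fst (js ! i) y - fst (snd (js ! i))\<bar>" for i y
  have "1 / Suc m \<le> mdist (map d js ! i) x y" if i: "i < length (map d js)" and PQ: "P i x \<and> Q i y" for i x y
  proof (rule ccontr)
    assume "\<not> ?thesis"
    moreover have j: "js ! i \<in> J" using i js by auto
    moreover have "1 / real (Suc m) \<le> 1 / real (Suc (k (js ! i)))"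
      using m[OF j] by (simp add: frac_le)
    ultimately have "mdist (d (js ! i)) x y < 1 / Suc (k (js ! i))" using i by simp
    from dk(2)[OF j this] PQ show False unfolding P_def Q_def by linarith
  qed
  moreover have "\<exists>i<length (map d js). P i x \<and> Q i y" if "X x \<and> \<not> X y" for x y
  proof -
    have "(e x, e y) \<in> Z"
      using that compactification_range[OF R] unfolding K_def[symmetric] e_def[symmetric]
      by (simp add: Z_def F(2))
    then obtain \<phi> c \<epsilon> where j: "(\<phi>, c, \<epsilon>) \<in> J" "\<bar>\<phi> x - c\<bar> < \<epsilon>" "2 * \<epsilon> < \<bar>\<phi> y - c\<bar>"
      using J(3)[of x y] by blast
    then obtain i where "i < length js" "js ! i = (\<phi>, c, \<epsilon>)"
      unfolding js[symmetric] in_set_conv_nth by blast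
    with j show ?thesis by (intro exI[of _ i]) (simp add: P_def Q_def)
  qed
  ultimately have "X \<in> separated_traces (map d js) m"
    unfolding separated_traces_def mem_Collect_eq
    by (intro exI[of _ P] exI[of _ Q] allI conjI impI) simp_all
  moreover have "map d js \<in> lists D"
    using dk(1) js by auto
  ultimately show ?thesis using that by blast
qed

text \<open>A point common to the closures of \<open>X\<close> and of its complement would have a
  neighbourhood on which every Urysohn function of the pairs varies by less than 1. But a member and
  a non-member of \<open>X\<close> taken from it are separated by some pair, with values 0 and
  1.\<close>

lemma separated_imp_clopen_traces:
  assumes D: "D \<subseteq> discrete_metrics" "D \<noteq> {}" and ds: "ds \<in> lists D"
    and X: "X \<in> separated_traces ds m"
  shows "X \<in> clopen_traces D"
proof -
  define R where "R = joint_functions D"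
  define K where "K = evaluation_space R"
  define e where "e = evaluation R"
  have R: "compactification (K, e)"
    using compactification_joint[OF D] unfolding joint_cpt_def R_def K_def e_def .
  obtain P Q where PQ: "\<And>i x y. \<lbrakk>i < length ds; P i x; Q i y\<rbrakk> \<Longrightarrow> 1 / Suc m \<le> mdist (ds ! i) x y"
    "\<And>x y. \<lbrakk>X x; \<not> X y\<rbrakk> \<Longrightarrow> \<exists>i<length ds. P i x \<and> Q i y"
    using X unfolding separated_traces_def by blast
  have "\<exists>\<phi>\<in>R. (\<forall>x. P i x \<longrightarrow> \<phi> x = 0) \<and> (\<forall>y. Q i y \<longrightarrow> \<phi> y = 1)" if i: "i < length ds" for i
  proof -
    have d: "ds ! i \<in> D" using ds i by auto
    then have dm: "ds ! i \<in> discrete_metrics" using D by blast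
    obtain \<phi> where \<phi>: "\<phi> \<in> bounded_uniformly_continuous (ds ! i)"
      "\<And>x. x \<in> {x. P i x} \<Longrightarrow> \<phi> x = 0" "\<And>y. y \<in> {y. Q i y} \<Longrightarrow> \<phi> y = 1"
      by (rule metric_Urysohn[OF dm, of "1 / Suc m" "{x. P i x}" "{y. Q i y}"])
        (use PQ(1)[OF i] in auto)
    have "\<phi> \<in> R" using \<phi>(1) d unfolding R_def joint_functions_def by blast
    with \<phi> show ?thesis by (intro bexI[of _ \<phi>]) auto
  qed
  then obtain \<phi> where \<phi>: "\<And>i. i < length ds \<Longrightarrow> \<phi> i \<in> R"
    "\<And>i x. \<lbrakk>i < length ds; P i x\<rbrakk> \<Longrightarrow> \<phi> i x = 0" "\<And>i y. \<lbrakk>i < length ds; Q i y\<rbrakk> \<Longrightarrow> \<phi> i y = 1"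
    by metis
  define A where "A = K closure_of (e ` {n. X n})"
  define B where "B = K closure_of (e ` {n. \<not> X n})"
  have eK: "e n \<in> topspace K" for n by (rule compactification_range[OF R])
  have "e ` {n. X n} \<union> e ` {n. \<not> X n} = range e" by blast
  then have AB: "A \<union> B = topspace K"
    using R unfolding A_def B_def closure_of_Un[symmetric] by simp
  have disj: "A \<inter> B = {}"
  proof (rule ccontr)
    assume "A \<inter> B \<noteq> {}"
    then obtain p where p: "p \<in> A" "p \<in> B" by blast
    \<comment> \<open>The factor \<open>topspace K\<close> keeps \<open>W\<close> inside
      \<open>K\<close> when \<open>ds\<close> is empty.\<close>
    define W where "W = topspace K \<inter> (\<Inter>i\<in>{..<length ds}. {z \<in> topspace K. z (\<phi> i) \<in> ball (p (\<phi> i)) (1/2)})"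
    have "openin K {z \<in> topspace K. z (\<phi> i) \<in> ball (p (\<phi> i)) (1/2)}" for i
      unfolding K_def
      by (rule openin_continuous_map_preimage[OF continuous_map_evaluation_space]) simp
    then have "openin K W"
      unfolding W_def by (intro openin_Int_Inter) auto
    moreover have "p \<in> W"
      using p AB by (auto simp: W_def)
    ultimately obtain x y where xy: "X x" "e x \<in> W" "\<not> X y" "e y \<in> W"
      using p unfolding A_def B_def in_closure_of by blast
    then obtain i where i: "i < length ds" "P i x" "Q i y" using PQ(2) by blast
    have "dist (p (\<phi> i)) (e x (\<phi> i)) < 1/2" "dist (p (\<phi> i)) (e y (\<phi> i)) < 1/2"
      using xy i by (auto simp: W_def)
    moreover have "e x (\<phi> i) = 0" "e y (\<phi> i) = 1"
      using \<phi>[OF i(1)] i by (simp_all add: e_def evaluation_def)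
    ultimately show False by (simp add: dist_real_def)
  qed
  have openAB: "openin K A" "openin K B"
  proof -
    have "A = topspace K - B" "B = topspace K - A" using AB disj by blast+
    then show "openin K A" "openin K B"
      by (metis A_def B_def closedin_closure_of openin_diff openin_topspace)+
  qed
  define F where "F z = (of_bool (z \<in> A) :: real)" for z
  have "continuous_map K euclideanreal F"
    unfolding continuous_map_def
  proof (intro conjI allI impI)
    fix U :: "real set"
    have "{z \<in> topspace K. F z \<in> U} = (if 1 \<in> U then A else {}) \<union> (if 0 \<in> U then B else {})"
      using AB disj by (auto simp: F_def)
    then show "openin K {z \<in> topspace K. F z \<in> U}" using openAB by auto
  qed simp
  moreover have "F (e n) = of_bool (X n)" for n
  proof -
    have "e ` {n. X n} \<subseteq> A" "e ` {n. \<not> X n} \<subseteq> B"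
      unfolding A_def B_def by (intro closure_of_subset; use eK in blast)+
    then show ?thesis using disj by (auto simp: F_def)
  qed
  moreover have "bounded (range (\<lambda>n. of_bool (X n) :: real))"
    by (rule bounded_subset[of "{0, 1}"]) auto
  ultimately show ?thesis
    unfolding clopen_traces_def joint_cpt_def mem_Collect_eq extendable_functions.simps
      K_def[unfolded R_def, symmetric] e_def[unfolded R_def, symmetric] by blast
qed

lemma clopen_traces_eq:
  assumes "D \<subseteq> discrete_metrics" "D \<noteq> {}"
  shows "clopen_traces D = (\<Union>ds\<in>lists D. \<Union>m. separated_traces ds m)"
proof (intro subset_antisym subsetI)
  fix X assume "X \<in> clopen_traces D"
  then obtain ds m where "ds \<in> lists D" "X \<in> separated_traces ds m"
    by (rule clopen_traces_imp_separated[OF assms])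
  then show "X \<in> (\<Union>ds\<in>lists D. \<Union>m. separated_traces ds m)"
    by (intro UN_I[of ds] UN_I[of m] UNIV_I)
next
  fix X assume "X \<in> (\<Union>ds\<in>lists D. \<Union>m. separated_traces ds m)"
  then show "X \<in> clopen_traces D"
    by (elim UN_E) (rule separated_imp_clopen_traces[OF assms])
qed

text \<open>The absolute difference of the two extensions works. This is the group structure on
  which both smallness arguments rest.\<close>

lemma clopen_traces_xor:
  assumes "X \<in> clopen_traces D" "Y \<in> clopen_traces D"
  shows "(\<lambda>n. X n \<noteq> Y n) \<in> clopen_traces D"
proof -
  obtain K e where Ke: "joint_cpt D = (K, e)" by (rule prod.exhaust)
  obtain F where F: "continuous_map K euclideanreal F" "\<And>n. F (e n) = of_bool (X n)"
    using assms(1) unfolding clopen_traces_def Ke by auto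
  obtain G where G: "continuous_map K euclideanreal G" "\<And>n. G (e n) = of_bool (Y n)"
    using assms(2) unfolding clopen_traces_def Ke by auto
  have "continuous_map K euclideanreal (\<lambda>z. \<bar>F z - G z\<bar>)"
    by (intro continuous_map_real_abs continuous_map_diff F(1) G(1))
  moreover have "\<bar>F (e n) - G (e n)\<bar> = of_bool (X n \<noteq> Y n)" for n
    by (simp add: F G)
  moreover have "bounded (range (\<lambda>n. of_bool (X n \<noteq> Y n) :: real))"
    by (rule bounded_subset[of "{0, 1}"]) auto
  ultimately show ?thesis
    unfolding clopen_traces_def Ke mem_Collect_eq extendable_functions.simps by blast
qed

lemma clopen_traces_finite:
  assumes D: "D \<subseteq> discrete_metrics" "D \<noteq> {}" and "finite {n. X n}"
  shows "X \<in> clopen_traces D"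
proof -
  have R: "\<phi> \<in> joint_functions D \<Longrightarrow> \<phi> \<in> extendable_functions (joint_cpt D)" for \<phi>
    unfolding joint_cpt_def by (intro extendable_evaluation joint_functions_bounded)
  obtain d where d: "d \<in> D" "d \<in> discrete_metrics" using D by blast
  have "(\<lambda>n. n \<in> A) \<in> clopen_traces D" if "finite A" for A
    using that
  proof induction
    case empty
    have "(\<lambda>_. 0) \<in> bounded_uniformly_continuous d"
      by (auto simp: bounded_uniformly_continuous_iff[OF d(2)] intro: exI[of _ 1])
    then have "(\<lambda>_. 0) \<in> extendable_functions (joint_cpt D)"
      using R d(1) unfolding joint_functions_def by blast
    then show ?case unfolding clopen_traces_def by (simp del: extendable_functions.simps)
  next
    case (insert a A)
    have "indicator {a} \<in> extendable_functions (joint_cpt D)"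
      using R d indicator_bounded_uniformly_continuous unfolding joint_functions_def by blast
    then have "(\<lambda>n. n \<in> {a}) \<in> clopen_traces D"
      unfolding clopen_traces_def mem_Collect_eq indicator_def .
    from clopen_traces_xor[OF insert.IH this]
    have "(\<lambda>n. (n \<in> A) \<noteq> (n \<in> {a})) \<in> clopen_traces D" .
    \<comment> \<open>Since \<open>a\<close> is new, inserting it is the same as taking the
      symmetric difference with its singleton.\<close>
    moreover have "(\<lambda>n. (n \<in> A) \<noteq> (n \<in> {a})) = (\<lambda>n. n \<in> insert a A)"
      using insert.hyps by (auto simp: fun_eq_iff)
    ultimately show ?case by simp
  qed
  from this[OF assms(3)] show ?thesis by simp
qed

section \<open>Category and measure in the Cantor space\<close>

lemma Cantor_topology_euclidean: "Cantor_topology = euclidean"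
proof -
  have "(discrete_topology UNIV :: bool topology) = euclidean"
    unfolding topology_eq openin_discrete_topology open_openin[symmetric] by (simp add: Topological_Spaces.open_discrete)
  then show ?thesis
    by (simp add: Cantor_topology_def euclidean_product_topology)
qed

lemma compact_UNIV_fun:
  assumes "compact (UNIV :: 'b::topological_space set)"
  shows "compact (UNIV :: ('a \<Rightarrow> 'b) set)"
proof -
  have "compact_space (euclidean :: 'b topology)"
    using assms by (simp add: compact_space_def)
  then have "compact_space (product_topology (\<lambda>_::'a. euclidean :: 'b topology) UNIV)"
    by (simp add: compact_space_product_topology)
  then show ?thesis
    by (simp add: euclidean_product_topology compact_space_def)
qed

lemma clopen_Collect:
  assumes "continuous_on UNIV (f :: 'a::topological_space \<Rightarrow> bool)"
  shows "closed {z. f z}" "open {z. f z}"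
proof -
  have eq: "{z. f z} = f -` {True}" by auto
  have op: "open A" for A :: "bool set" by (rule Topological_Spaces.open_discrete)
  show "closed {z. f z}"
    unfolding eq by (rule closed_vimage[OF _ assms]) (simp add: closed_def op)
  show "open {z. f z}"
    unfolding eq by (rule open_vimage[OF op assms])
qed

text \<open>\<open>separated_traces ds m\<close> is the projection of a closed set along a compact factor.\<close>

lemma closedin_separated_traces: "closedin Cantor_topology (separated_traces ds m)"
proof -
  define S :: "((nat \<Rightarrow> bool) \<times> (nat \<Rightarrow> nat \<Rightarrow> bool) \<times> (nat \<Rightarrow> nat \<Rightarrow> bool)) set"
    where "S = {z. \<forall>x y.
      (\<forall>i<length ds. fst (snd z) i x \<and> snd (snd z) i y \<longrightarrow> 1 / Suc m \<le> mdist (ds ! i) x y) \<and>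
      (fst z x \<and> \<not> fst z y \<longrightarrow> (\<exists>i<length ds. fst (snd z) i x \<and> snd (snd z) i y))}"
  have X: "continuous_on UNIV (\<lambda>z :: (nat \<Rightarrow> bool) \<times> (nat \<Rightarrow> nat \<Rightarrow> bool) \<times> (nat \<Rightarrow> nat \<Rightarrow> bool). fst z x)" for x
    by (rule continuous_on_product_then_coordinatewise) (intro continuous_on_fst continuous_on_id)
  have P: "continuous_on UNIV (\<lambda>z :: (nat \<Rightarrow> bool) \<times> (nat \<Rightarrow> nat \<Rightarrow> bool) \<times> (nat \<Rightarrow> nat \<Rightarrow> bool). fst (snd z) i x)" for i x
    by (rule continuous_on_product_then_coordinatewise, rule continuous_on_product_then_coordinatewise)
      (intro continuous_on_fst continuous_on_snd continuous_on_id)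
  have Q: "continuous_on UNIV (\<lambda>z :: (nat \<Rightarrow> bool) \<times> (nat \<Rightarrow> nat \<Rightarrow> bool) \<times> (nat \<Rightarrow> nat \<Rightarrow> bool). snd (snd z) i x)" for i x
    by (rule continuous_on_product_then_coordinatewise, rule continuous_on_product_then_coordinatewise)
      (intro continuous_on_fst continuous_on_snd continuous_on_id)
  \<comment> \<open>Rewriting the bounded existential as a finite union shows that it is a closed
    condition.\<close>
  have ex: "{z. \<exists>i<length ds. fst (snd z) i x \<and> snd (snd z) i y} =
    (\<Union>i\<in>{..<length ds}. {z. fst (snd z) i x} \<inter> {z. snd (snd z) i y})" for x y
    by blast
  have E: "closed {z :: (nat \<Rightarrow> bool) \<times> (nat \<Rightarrow> nat \<Rightarrow> bool) \<times> (nat \<Rightarrow> nat \<Rightarrow> bool).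
      \<exists>i<length ds. fst (snd z) i x \<and> snd (snd z) i y}" for x y
    unfolding ex by (intro closed_UN closed_Int clopen_Collect P Q finite_lessThan ballI)
  have "closed S"
    unfolding S_def
    by (intro closed_Collect_all closed_Collect_conj closed_Collect_imp closed_Collect_const
        open_Collect_conj open_Collect_neg open_Collect_const E
        clopen_Collect[OF X] clopen_Collect[OF P] clopen_Collect[OF Q])
  moreover have "compact (UNIV :: bool set)"
    by (rule finite_imp_compact) simp
  then have "compact (UNIV :: ((nat \<Rightarrow> bool) \<times> (nat \<Rightarrow> nat \<Rightarrow> bool) \<times> (nat \<Rightarrow> nat \<Rightarrow> bool)) set)"
    unfolding UNIV_Times_UNIV[symmetric] by (intro compact_Times compact_UNIV_fun)
  ultimately have "compact S"
    using compact_Int_closed[of UNIV S] by simp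
  then have "compact (fst ` S)"
    by (intro compact_continuous_image continuous_on_fst continuous_on_id)
  moreover have "fst ` S = {X. \<exists>P Q. (X, P, Q) \<in> S}" by force
  then have "fst ` S = separated_traces ds m"
    unfolding S_def separated_traces_def by simp
  ultimately have "compactin Cantor_topology (separated_traces ds m)"
    by (simp add: Cantor_topology_euclidean)
  then show ?thesis
    by (rule compactin_imp_closedin[rotated])
      (simp add: Cantor_topology_def Hausdorff_space_product_topology)
qed

section \<open>Cylinders and measurability of closed sets\<close>

lemma openin_Cantor_cylinder:
  assumes "openin Cantor_topology V" "X \<in> V"
  obtains n where "\<And>Y. (\<And>i. i < n \<Longrightarrow> Y i = X i) \<Longrightarrow> Y \<in> V"
proof -
  obtain U where U: "X \<in> (\<Pi>\<^sub>E i\<in>UNIV. U i)" "finite {i. U i \<noteq> UNIV}" "(\<Pi>\<^sub>E i\<in>UNIV. U i) \<subseteq> V"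
    using product_topology_open_contains_basis[OF assms[unfolded Cantor_topology_def]] by auto
  obtain n where n: "\<forall>i\<in>{i. U i \<noteq> UNIV}. i < n"
    using U(2) unfolding finite_nat_set_iff_bounded by blast
  show ?thesis
  proof (rule that)
    fix Y assume "\<And>i. i < n \<Longrightarrow> Y i = X i"
    then have "Y i \<in> U i" for i
      using U(1) n by (cases "U i = UNIV") (auto simp: PiE_iff)
    then show "Y \<in> V" using U(3) by (auto simp: PiE_iff)
  qed
qed

lemma space_Cantor_measure [simp]: "space Cantor_measure = UNIV"
  by (simp add: Cantor_measure_def space_PiM)

lemma measurable_Cantor_coordinate:
  "(\<lambda>X. X i) \<in> measurable Cantor_measure (measure_pmf (bernoulli_pmf (1/2)))"
  unfolding Cantor_measure_def by (rule measurable_component_singleton) simp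

lemma sets_Cantor_cylinder: "{X. \<forall>i<n. X i = Y i} \<in> sets Cantor_measure"
proof -
  have "(\<lambda>X. X i) -` {b} \<inter> space Cantor_measure \<in> sets Cantor_measure" for i b
    by (rule measurable_sets[OF measurable_Cantor_coordinate]) simp
  then have "{X \<in> space Cantor_measure. \<forall>i\<in>{..<n}. X i = Y i} \<in> sets Cantor_measure"
    by (intro sets.sets_Collect_finite_All) (auto simp: vimage_def)
  then show ?thesis by (simp add: Ball_def)
qed

text \<open>The complement is a union of cylinders given by finite boolean lists, and there are only
  countably many such lists.\<close>

lemma sets_Cantor_closedin:
  assumes "closedin Cantor_topology C"
  shows "C \<in> sets Cantor_measure"
proof -
  define cyl where "cyl l = {X. \<forall>i<length l. X i = l ! i}" for l :: "bool list"
  have V: "openin Cantor_topology (- C)"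
    using assms by (simp add: closedin_def Cantor_topology_def Compl_eq_Diff_UNIV)
  have "- C \<subseteq> (\<Union>l\<in>{l. cyl l \<subseteq> - C}. cyl l)"
  proof
    fix X assume "X \<in> - C"
    then obtain n where n: "\<And>Y. (\<And>i. i < n \<Longrightarrow> Y i = X i) \<Longrightarrow> Y \<in> - C"
      using openin_Cantor_cylinder[OF V] by blast
    have "cyl (map X [0..<n]) \<subseteq> - C" "X \<in> cyl (map X [0..<n])"
      using n by (auto simp: cyl_def)
    then show "X \<in> (\<Union>l\<in>{l. cyl l \<subseteq> - C}. cyl l)" by blast
  qed
  then have "- C = (\<Union>l\<in>{l. cyl l \<subseteq> - C}. cyl l)" by blast
  also have "\<dots> \<in> sets Cantor_measure"
    using sets_Cantor_cylinder by (intro sets.countable_UN') (auto simp: cyl_def)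
  finally show ?thesis
    by (metis Compl_eq_Diff_UNIV double_compl sets.compl_sets space_Cantor_measure)
qed

section \<open>Nowhere density by finite modifications\<close>

lemma clopen_traces_cong_finite:
  assumes D: "D \<subseteq> discrete_metrics" "D \<noteq> {}"
    and "X \<in> clopen_traces D" "finite {n. X n \<noteq> Y n}"
  shows "Y \<in> clopen_traces D"
proof -
  have "(\<lambda>n. X n \<noteq> (X n \<noteq> Y n)) \<in> clopen_traces D"
    by (intro clopen_traces_xor clopen_traces_finite D assms)
  moreover have "(\<lambda>n. X n \<noteq> (X n \<noteq> Y n)) = Y" by (rule ext) blast
  ultimately show ?thesis by simp
qed

text \<open>If the closed set contained a cylinder, any \<open>Y\<close> could be changed in
  finitely many places to lie in it. Invariance under finite changes would then put every
  \<open>Y\<close> into the proper algebra.\<close>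

lemma nowhere_dense_separated_traces:
  assumes D: "D \<subseteq> discrete_metrics" "D \<noteq> {}" and neq: "clopen_traces D \<noteq> UNIV"
    and ds: "ds \<in> lists D"
  shows "nowhere_dense_in Cantor_topology (separated_traces ds m)"
proof -
  let ?C = "separated_traces ds m"
  have "Cantor_topology interior_of ?C = {}"
  proof (rule ccontr)
    assume "Cantor_topology interior_of ?C \<noteq> {}"
    then obtain X U where U: "openin Cantor_topology U" "X \<in> U" "U \<subseteq> ?C"
      unfolding interior_of_def by blast
    obtain n where n: "\<And>Y. (\<And>i. i < n \<Longrightarrow> Y i = X i) \<Longrightarrow> Y \<in> U"
      using openin_Cantor_cylinder[OF U(1,2)] by blast
    have "Y \<in> clopen_traces D" for Y
    proof (rule clopen_traces_cong_finite[OF D])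
      have "(\<lambda>i. if i < n then X i else Y i) \<in> ?C" using n U(3) by auto
      then show "(\<lambda>i. if i < n then X i else Y i) \<in> clopen_traces D"
        by (rule separated_imp_clopen_traces[OF D ds])
      show "finite {i. (if i < n then X i else Y i) \<noteq> Y i}"
        by (rule finite_subset[of _ "{..<n}"]) auto
    qed
    with neq show False by blast
  qed
  then show ?thesis
    unfolding nowhere_dense_in_def closure_of_closedin[OF closedin_separated_traces]
    by (simp add: Cantor_topology_def)
qed

section \<open>Independence, translation invariance and the zero-one law\<close>

lemma prob_space_Cantor: "prob_space Cantor_measure"
  unfolding Cantor_measure_def by (intro prob_space_PiM prob_space_measure_pmf)

lemma indep_vars_Cantor:
  "prob_space.indep_vars Cantor_measure (\<lambda>_. measure_pmf (bernoulli_pmf (1/2))) (\<lambda>i X. X i) UNIV"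
proof -
  interpret prob_space Cantor_measure by (rule prob_space_Cantor)
  show ?thesis
  proof (subst indep_vars_iff_distr_eq_PiM)
    have "distr Cantor_measure (measure_pmf (bernoulli_pmf (1/2))) (\<lambda>X. X i) =
        measure_pmf (bernoulli_pmf (1/2))" for i
      unfolding Cantor_measure_def
      by (rule distr_PiM_component) (auto intro: prob_space_measure_pmf)
    then show "distr Cantor_measure (Pi\<^sub>M UNIV (\<lambda>_. measure_pmf (bernoulli_pmf (1/2))))
        (\<lambda>X. \<lambda>i\<in>UNIV. X i) =
      Pi\<^sub>M UNIV (\<lambda>i. distr Cantor_measure (measure_pmf (bernoulli_pmf (1/2))) (\<lambda>X. X i))"
      by (simp add: Cantor_measure_def[symmetric] restrict_def distr_id)
  qed (rule UNIV_not_empty measurable_Cantor_coordinate)+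
qed

text \<open>A fair coin is symmetric under flipping, and independent coordinates stay independent
  when some are flipped.\<close>

lemma distr_Cantor_xor: "distr Cantor_measure Cantor_measure (\<lambda>X i. X i \<noteq> A i) = Cantor_measure"
proof -
  define B where "B = measure_pmf (bernoulli_pmf (1/2))"
  have M: "Cantor_measure = Pi\<^sub>M UNIV (\<lambda>_. B)"
    by (simp add: Cantor_measure_def B_def)
  interpret prob_space Cantor_measure by (rule prob_space_Cantor)
  have meas: "(\<lambda>b. b \<noteq> a) \<in> measurable B B" for a by (simp add: B_def)
  have coord: "(\<lambda>X. X i) \<in> measurable Cantor_measure B" for i
    using measurable_Cantor_coordinate by (simp add: B_def)
  have "map_pmf (\<lambda>b. b \<noteq> a) (bernoulli_pmf (1/2)) = bernoulli_pmf (1/2)" for a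
  proof (rule pmf_eqI)
    fix b
    have "(\<lambda>b. b \<noteq> a) -` {b} = {b \<noteq> a}" by auto
    then show "pmf (map_pmf (\<lambda>b. b \<noteq> a) (bernoulli_pmf (1/2))) b = pmf (bernoulli_pmf (1/2)) b"
      by (cases "b \<noteq> a"; cases b) (simp_all add: pmf_map measure_pmf_single)
  qed
  then have flip: "distr B B (\<lambda>b. b \<noteq> a) = B" for a
    unfolding B_def by (metis distr_cong map_pmf_rep_eq sets_measure_pmf_count_space)
  have rv: "(\<lambda>X. X i \<noteq> A i) \<in> measurable Cantor_measure B" for i
    by (rule measurable_compose[OF coord meas])
  have "indep_vars (\<lambda>_. B) (\<lambda>i X. X i \<noteq> A i) UNIV"
    using indep_vars_compose2[OF indep_vars_Cantor[folded B_def], of "\<lambda>i b. b \<noteq> A i" "\<lambda>_. B"] meas by simp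
  then have joint: "distr Cantor_measure (Pi\<^sub>M UNIV (\<lambda>_. B)) (\<lambda>X. \<lambda>i\<in>UNIV. X i \<noteq> A i) =
      Pi\<^sub>M UNIV (\<lambda>i. distr Cantor_measure B (\<lambda>X. X i \<noteq> A i))"
    unfolding indep_vars_iff_distr_eq_PiM[OF UNIV_not_empty rv] .
  have marginal: "distr Cantor_measure B (\<lambda>X. X i \<noteq> A i) = B" for i
  proof -
    have "distr Cantor_measure B (\<lambda>X. X i) = B"
      unfolding M by (rule distr_PiM_component) (auto simp: B_def intro: prob_space_measure_pmf)
    then have "distr Cantor_measure B (\<lambda>X. X i \<noteq> A i) = distr B B (\<lambda>b. b \<noteq> A i)"
      using distr_distr[OF meas coord, of i "A i"] by (simp add: comp_def)
    then show ?thesis unfolding flip .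
  qed
  show ?thesis using joint unfolding marginal restrict_UNIV M[symmetric] .
qed

text \<open>Invariance under finite changes makes \<open>S\<close> a tail event of the independent
  coordinates, so Kolmogorov's law applies.\<close>

lemma Cantor_0_1_law:
  assumes S: "S \<in> sets Cantor_measure"
    and inv: "\<And>X Y. \<lbrakk>X \<in> S; finite {n. X n \<noteq> Y n}\<rbrakk> \<Longrightarrow> Y \<in> S"
  shows "measure Cantor_measure S = 0 \<or> measure Cantor_measure S = 1"
proof -
  define B where "B = measure_pmf (bernoulli_pmf (1/2))"
  interpret prob_space Cantor_measure by (rule prob_space_Cantor)
  define \<A> where "\<A> i = sigma_sets (space Cantor_measure)
    {(\<lambda>X. X i) -` A \<inter> space Cantor_measure |A. A \<in> sets B}" for i :: nat
  show ?thesis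
  proof (rule kolmogorov_0_1_law[of \<A>])
    show "sigma_algebra (space Cantor_measure) (\<A> i)" for i
      unfolding \<A>_def by (rule sigma_algebra_sigma_sets) auto
    show "indep_sets \<A> UNIV"
      using indep_vars_Cantor unfolding indep_vars_def \<A>_def B_def by blast
    show "S \<in> tail_events \<A>"
      unfolding tail_events_def
    proof
      fix n
      define N where "N = sigma (space Cantor_measure) (\<Union> (\<A> ` {n..}))"
      have sub: "\<Union> (\<A> ` {n..}) \<subseteq> Pow (space Cantor_measure)" by simp
      have sN: "space N = UNIV" by (simp add: N_def space_measure_of[OF sub])
      have coord: "(\<lambda>X. if i < n then False else X i) \<in> measurable N B" for i
      proof (cases "i < n")
        case True
        then show ?thesis by (simp add: B_def)
      next
        case False
        have "(\<lambda>X. X i) \<in> measurable N B"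
        proof (rule measurableI)
          fix A assume "A \<in> sets B"
          then have "(\<lambda>X. X i) -` A \<inter> space Cantor_measure \<in> \<A> i"
            unfolding \<A>_def by (intro sigma_sets.Basic) blast
          then have "(\<lambda>X. X i) -` A \<inter> space Cantor_measure \<in> \<Union> (\<A> ` {n..})"
            using False by (intro UN_I[of i]) auto
          then show "(\<lambda>X. X i) -` A \<inter> space N \<in> sets N"
            unfolding N_def sets_measure_of[OF sub] by (intro sigma_sets.Basic) (simp add: space_measure_of_conv)
        qed (simp add: B_def)
        with False show ?thesis by simp
      qed
      \<comment> \<open>Overwriting the first \<open>n\<close> values uses only the later
        coordinates, and by invariance \<open>S\<close> is its own preimage under this map.\<close>
      have h: "(\<lambda>X i. if i < n then False else X i) \<in> measurable N Cantor_measure"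
        unfolding Cantor_measure_def B_def[symmetric]
        by (rule measurable_PiM_single'[OF coord]) (simp add: B_def)
      have "S = (\<lambda>X i. if i < n then False else X i) -` S \<inter> space N"
      proof -
        have fin: "finite {i. X i \<noteq> (if i < n then False else X i)}"
          "finite {i. (if i < n then False else X i) \<noteq> X i}" for X :: "nat \<Rightarrow> bool"
          by (rule finite_subset[of _ "{..<n}"]; auto)+
        have "X \<in> S \<longleftrightarrow> (\<lambda>i. if i < n then False else X i) \<in> S" for X
          using inv[OF _ fin(1)] inv[OF _ fin(2)] by blast
        then show ?thesis by (simp add: sN vimage_def)
      qed
      also have "\<dots> \<in> sets N" by (rule measurable_sets[OF h S])
      finally show "S \<in> sigma_sets (space Cantor_measure) (\<Union> (\<A> ` {n..}))"
        by (simp add: N_def sets_measure_of[OF sub])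
    qed
  qed
qed

text \<open>If \<open>S\<close> had full measure, so would the disjoint translate of \<open>S\<close> by a point outside \<open>S\<close>.\<close>

lemma null_sets_Cantor_subgroup:
  assumes S: "S \<in> sets Cantor_measure" and "S \<noteq> UNIV"
    and xor: "\<And>X Y. \<lbrakk>X \<in> S; Y \<in> S\<rbrakk> \<Longrightarrow> (\<lambda>n. X n \<noteq> Y n) \<in> S"
    and fin: "\<And>X. finite {n. X n} \<Longrightarrow> X \<in> S"
  shows "S \<in> null_sets Cantor_measure"
proof -
  interpret prob_space Cantor_measure by (rule prob_space_Cantor)
  obtain A where A: "A \<notin> S" using \<open>S \<noteq> UNIV\<close> by blast
  define T where "T = (\<lambda>X i. X i \<noteq> A i) -` S \<inter> space Cantor_measure"
  have meas: "(\<lambda>X i. X i \<noteq> A i) \<in> measurable Cantor_measure Cantor_measure"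
    unfolding Cantor_measure_def
    by (rule measurable_PiM_single')
      (auto simp: space_PiM intro: measurable_compose[OF measurable_Cantor_coordinate[unfolded Cantor_measure_def]])
  have T: "T \<in> sets Cantor_measure" unfolding T_def by (rule measurable_sets[OF meas S])
  have "measure (distr Cantor_measure Cantor_measure (\<lambda>X i. X i \<noteq> A i)) S = prob T"
    unfolding T_def by (rule measure_distr[OF meas S])
  then have eq: "prob T = prob S" unfolding distr_Cantor_xor by simp
  \<comment> \<open>A point of \<open>S\<close> whose translate by \<open>A\<close> is also in
    \<open>S\<close> would put \<open>A\<close> into \<open>S\<close>, as the symmetric difference
    of the two.\<close>
  have "S \<inter> T = {}"
  proof (rule ccontr)
    assume "S \<inter> T \<noteq> {}"
    then obtain X where "X \<in> S" "(\<lambda>i. X i \<noteq> A i) \<in> S" by (auto simp: T_def)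
    from xor[OF this] have "(\<lambda>n. X n \<noteq> (X n \<noteq> A n)) \<in> S" .
    moreover have "(\<lambda>n. X n \<noteq> (X n \<noteq> A n)) = A" by (rule ext) blast
    ultimately show False using A by simp
  qed
  then have "prob S + prob T \<le> 1"
    using finite_measure_Union[OF S T] prob_le_1[of "S \<union> T"] by simp
  then have "prob S \<noteq> 1" using eq by simp
  moreover have "prob S = 0 \<or> prob S = 1"
  proof (rule Cantor_0_1_law[OF S])
    fix X Y assume "X \<in> S" "finite {n. X n \<noteq> Y n}"
    from xor[OF this(1) fin[OF this(2)]] have "(\<lambda>n. X n \<noteq> (X n \<noteq> Y n)) \<in> S" .
    moreover have "(\<lambda>n. X n \<noteq> (X n \<noteq> Y n)) = Y" by (rule ext) blast
    ultimately show "Y \<in> S" by simp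
  qed
  ultimately have "emeasure Cantor_measure S = 0" by (simp add: emeasure_eq_measure)
  with S show ?thesis by (rule null_setsI[rotated])
qed

text \<open>Finiteness of \<open>D\<close> leaves countably many lists over it, so the algebra is a
  countable union of closed sets and hence measurable.\<close>

lemma null_sets_clopen_traces:
  assumes D: "D \<subseteq> discrete_metrics" "D \<noteq> {}" "finite D" and neq: "clopen_traces D \<noteq> UNIV"
  shows "clopen_traces D \<in> null_sets Cantor_measure"
proof (rule null_sets_Cantor_subgroup[OF _ neq])
  have "(\<Union>m. separated_traces ds m) \<in> sets Cantor_measure" for ds
    by (intro sets.countable_UN image_subsetI sets_Cantor_closedin closedin_separated_traces)
  then show "clopen_traces D \<in> sets Cantor_measure"
    unfolding clopen_traces_eq[OF D(1,2)]
    by (rule sets.countable_UN'[OF countable_lists[OF countable_finite[OF D(3)]] image_subsetI])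
qed (rule clopen_traces_xor clopen_traces_finite[OF D(1,2)], assumption+)+

section \<open>Cardinalities\<close>

text \<open>Cardinals are well-ordered, so the choice inside \<open>least_card\<close> has a witness
  as soon as some set satisfies \<open>P\<close>.\<close>

lemma least_card_cases:
  obtains (Card) A where "P A" "\<And>B. P B \<Longrightarrow> |A| \<le>o |B|" "least_card P = Card |A|"
  | (Infty) "\<And>A. \<not> P A" "least_card P = Infty"
proof (cases "\<exists>A. P A")
  case True
  then have "card_of ` {A. P A} \<noteq> {}" by blast
  then have "\<exists>r\<in>card_of ` {A. P A}. \<forall>r'\<in>card_of ` {A. P A}. r \<le>o r'"
    by (rule exists_minim_Well_order) (auto simp: card_of_Well_order)
  then have "\<exists>A. P A \<and> (\<forall>B. P B \<longrightarrow> |A| \<le>o |B| )" by blast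
  from someI_ex[OF this] True show ?thesis
    by (intro Card[of "SOME A. P A \<and> (\<forall>B. P B \<longrightarrow> |A| \<le>o |B| )"])
      (simp_all add: least_card_def)
next
  case False
  then show ?thesis by (intro Infty) (simp_all add: least_card_def)
qed

lemma ext_card_le_least_card:
  assumes "\<And>A. Q A \<Longrightarrow> \<exists>B. P B \<and> |B| \<le>o |A|"
  shows "ext_card_le (least_card P) (least_card Q)"
proof (cases Q rule: least_card_cases)
  case (Card A)
  obtain B where B: "P B" "|B| \<le>o |A|" using assms[OF Card(1)] by blast
  show ?thesis
  proof (cases P rule: least_card_cases)
    fix B' assume "P B'" "\<And>B. P B \<Longrightarrow> |B'| \<le>o |B|" "least_card P = ext_card.Card |B'|"
    then show ?thesis using B Card(3) ordLeq_transitive by auto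
  next
    assume "\<And>A. \<not> P A"
    with B show ?thesis by blast
  qed
next
  case Infty
  then show ?thesis by simp
qed

text \<open>For each length there are at most \<open>|D|\<close> lists, by induction and the product
  rule for infinite cardinals; countably many lengths add nothing.\<close>

lemma card_of_lists_infinite_le:
  assumes "infinite D"
  shows "|lists D| \<le>o |D|"
proof -
  have n: "|{xs \<in> lists D. length xs = n}| \<le>o |D|" for n
  proof (induction n)
    case 0
    have "{xs \<in> lists D. length xs = 0} = {[]}" by auto
    moreover have "D \<noteq> {}" using assms by auto
    ultimately show ?case by (simp add: card_of_singl_ordLeq)
  next
    case (Suc n)
    have "{xs \<in> lists D. length xs = Suc n} \<subseteq>
        (\<lambda>(x, xs). x # xs) ` (D \<times> {xs \<in> lists D. length xs = n})"
    proof
      fix xs assume xs: "xs \<in> {xs \<in> lists D. length xs = Suc n}"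
      then obtain y ys where "xs = y # ys" by (cases xs) auto
      with xs show "xs \<in> (\<lambda>(x, xs). x # xs) ` (D \<times> {xs \<in> lists D. length xs = n})"
        by (intro image_eqI[of _ _ "(y, ys)"]) auto
    qed
    then have "|{xs \<in> lists D. length xs = Suc n}| \<le>o |D \<times> {xs \<in> lists D. length xs = n}|"
      by (rule ordLeq_transitive[OF card_of_mono1 card_of_image])
    also have "|D \<times> {xs \<in> lists D. length xs = n}| \<le>o |D|"
      by (intro card_of_Sigma_ordLeq_infinite assms ballI Suc.IH ordLeq_refl card_of_Card_order)
    finally show ?case .
  qed
  have "lists D = (\<Union>n. {xs \<in> lists D. length xs = n})" by blast
  also have "|\<dots>| \<le>o |D|"
    by (intro card_of_UNION_ordLeq_infinite assms ballI n infinite_iff_card_of_nat[THEN iffD1])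
  finally show ?thesis .
qed

text \<open>The covering argument common to both ideals: lists over \<open>D\<close> index a cover
  of the Cantor space. The ideal enters only through the smallness of the sets belonging to finite
  subfamilies.\<close>

lemma cov_le_sp:
  assumes small: "\<And>F ds. \<lbrakk>F \<subseteq> discrete_metrics; F \<noteq> {}; finite F; clopen_traces F \<noteq> UNIV;
      ds \<in> lists F\<rbrakk> \<Longrightarrow> (\<Union>m. separated_traces ds m) \<in> \<X>"
  shows "ext_card_le (cov \<X>) sp"
  unfolding cov_def sp_def
proof (rule ext_card_le_least_card)
  fix D
  assume D: "D \<subseteq> non_Stone_Cech_metrics \<and> Smirnov_FIP D \<and>
    cpt_equiv Stone_Cech (cpt_sup (Smirnov ` D))"
  then have fip: "\<not> cpt_equiv Stone_Cech (cpt_sup (Smirnov ` F))" if "finite F" "F \<subseteq> D" for F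
    using that unfolding Smirnov_FIP_def by blast
  \<comment> \<open>A finite \<open>D\<close> would be one of its own finite subsets and so
    contradict the FIP.\<close>
  have inf: "infinite D" using fip D by blast
  then have ne: "D \<noteq> {}" by auto
  then obtain d0 where d0: "d0 \<in> D" by blast
  have dm: "D \<subseteq> discrete_metrics" using D unfolding non_Stone_Cech_metrics_def by blast
  define \<Y> where "\<Y> = (\<lambda>ds. \<Union>m. separated_traces ds m) ` lists D"
  have "(\<Union>m. separated_traces ds m) \<in> \<X>" if ds: "ds \<in> lists D" for ds
  \<comment> \<open>Adding \<open>d0\<close> makes the finite family nonempty even for the empty
    list.\<close>
  proof (rule small[of "insert d0 (set ds)"])
    have F: "insert d0 (set ds) \<subseteq> D" using ds d0 by auto
    then show "insert d0 (set ds) \<subseteq> discrete_metrics" using dm by blast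
    then show "clopen_traces (insert d0 (set ds)) \<noteq> UNIV"
      using fip[OF _ F] cpt_equiv_sup_iff_traces[of "insert d0 (set ds)"] by blast
  qed auto
  then have "\<Y> \<subseteq> \<X>" unfolding \<Y>_def by blast
  moreover have "\<Union>\<Y> = UNIV"
    using D cpt_equiv_sup_iff_traces[OF dm ne] clopen_traces_eq[OF dm ne] unfolding \<Y>_def by simp
  moreover have "|\<Y>| \<le>o |D|"
    unfolding \<Y>_def using card_of_image card_of_lists_infinite_le[OF inf] by (rule ordLeq_transitive)
  ultimately show "\<exists>\<Y>. (\<Y> \<subseteq> \<X> \<and> \<Union>\<Y> = UNIV) \<and> |\<Y>| \<le>o |D|" by blast
qed

theorem corollary3p7:
  shows "ext_card_le (cov meager_sets) sp \<and> ext_card_le (cov measure_zero_sets) sp"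
proof
  show "ext_card_le (cov meager_sets) sp"
  proof (rule cov_le_sp)
    fix F ds
    assume "F \<subseteq> discrete_metrics" "F \<noteq> {}" "clopen_traces F \<noteq> UNIV" "ds \<in> lists F"
    then show "(\<Union>m. separated_traces ds m) \<in> meager_sets"
      unfolding meager_sets_def mem_Collect_eq
      by (intro exI[of _ "separated_traces ds"] conjI allI nowhere_dense_separated_traces refl)
  qed
  show "ext_card_le (cov measure_zero_sets) sp"
  proof (rule cov_le_sp)
    fix F ds
    assume F: "F \<subseteq> discrete_metrics" "F \<noteq> {}" "finite F" "clopen_traces F \<noteq> UNIV" "ds \<in> lists F"
    \<comment> \<open>The whole algebra of the finite family is null, and the completion passes this
      on to subsets.\<close>
    have "(\<Union>m. separated_traces ds m) \<subseteq> clopen_traces F"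
      by (rule UN_least, rule subsetI, rule separated_imp_clopen_traces[OF F(1,2,5)])
    then show "(\<Union>m. separated_traces ds m) \<in> measure_zero_sets"
      unfolding measure_zero_sets_def
      by (rule null_sets_completion_subset)
        (intro null_sets_completionI null_sets_clopen_traces F)
  qed
qed

end
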